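(* Let $\mathcal{M}$ be a moon polyomino with $m$ columns, let $\mathbf{s}=(s_1,\dots,s_m)$ be an $m$-tuple of nonnegative integers and let $A$ be a subset of the rows of $\mathcal{M}$. Then $$\sum_{M\in\mathbf{F}(\mathcal{M},\mathbf{s};A)}q^{\mathrm{maj}(M)}=\sum_{M\in\mathbf{F}(\mathcal{M},\mathbf{s};A)}q^{\mathrm{ne}(M)} .$$
   Context: **Polyominoes.** A polyomino is a finite subset of $\mathbb{Z}^2$ whose elements are drawn as square cells. It is convex if its intersection with any row or column is connected, and intersection-free if any two of its columns are comparable, i.e. the set of row-coordinates of one is contained in that of the other (equivalently, any two rows are comparable). A moon polyomino is a convex intersection-free polyomino. Its columns are labelled $c_1,\dots,c_m$ from left to right. **Fillings.** A filling of a moon polyomino $\mathcal{M}$ assigns $0$ or $1$ to each cell with at most one $1$ in each row; a 1-cell is a cell assigned $1$; a row is empty if it contains no 1-cell. $\mathbf{F}(\mathcal{M},\mathbf{s};A)$ is the set of fillings of $\mathcal{M}$ whose empty rows are exactly those in $A$ and in which column $c_i$ has exactly $s_i$ 1's for each $i$. An NE chain of a filling $M$ of $\mathcal{M}$ is a pair of 1-cells, one strictly above and strictly to the right of the other, such that the smallest rectangle containing them is contained in $\mathcal{M}$; $\mathrm{ne}(M)$ is the number of NE chains of $M$. **Major index.** For a filling $R$ of a rectangle with nonempty rows $r_1,\dots,r_n$ from top to bottom, $\mathrm{des}(R)$ is the number of $i$ such that the 1-cells of $r_i$ and $r_{i+1}$ form an NE chain; $R(r_i)$ is the restriction of $R$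 to the row $r_i$ and all rows above it; and $\mathrm{maj}(R)=\sum_{i=1}^n\mathrm{des}(R(r_i))$. For a filling $M$ of a moon polyomino $\mathcal{M}$, let $\mathcal{R}_1,\dots,\mathcal{R}_r$ be all the maximal rectangles contained in $\mathcal{M}$, ordered increasingly by height, and $R_i$ the restriction of $M$ to $\mathcal{R}_i$. Then $\mathrm{maj}(M)=\sum_{i=1}^r\mathrm{maj}(R_i)-\sum_{i=1}^{r-1}\mathrm{maj}(R_i\cap R_{i+1})$, where $R_i\cap R_{i+1}$ is the restriction of $M$ to $\mathcal{R}_i\cap\mathcal{R}_{i+1}$. *)

theory Defs
  imports Complex_Main "HOL-Library.FuncSet"
begin

(* The cell (x, y) lies in column x and row y; x increases to the right, y increases upwards. *)
type_synonym cell = "int \<times> int"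

definition columns :: "cell set \<Rightarrow> int set" where
  "columns P = fst ` P"

definition rows :: "cell set \<Rightarrow> int set" where
  "rows P = snd ` P"

definition column_cells :: "cell set \<Rightarrow> int \<Rightarrow> int set" where
  "column_cells P x = {y. (x, y) \<in> P}"

definition row_cells :: "cell set \<Rightarrow> int \<Rightarrow> int set" where
  "row_cells P y = {x. (x, y) \<in> P}"

definition contiguous :: "int set \<Rightarrow> bool" where
  "contiguous S \<longleftrightarrow> (\<forall>a\<in>S. \<forall>b\<in>S. {a..b} \<subseteq> S)"

definition polyomino :: "cell set \<Rightarrow> bool" where
  "polyomino P \<longleftrightarrow> finite P"

definition convex_polyomino :: "cell set \<Rightarrow> bool" where
  "convex_polyomino P \<longleftrightarrow> polyomino P \<and>
     (\<forall>x. contiguous (column_cells P x)) \<and> (\<forall>y. contiguous (row_cells P y))"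

definition intersection_free :: "cell set \<Rightarrow> bool" where
  "intersection_free P \<longleftrightarrow>
     (\<forall>x\<in>columns P. \<forall>x'\<in>columns P.
        column_cells P x \<subseteq> column_cells P x' \<or> column_cells P x' \<subseteq> column_cells P x)"

definition moon_polyomino :: "cell set \<Rightarrow> bool" where
  "moon_polyomino P \<longleftrightarrow> convex_polyomino P \<and> intersection_free P"

(* The 1-cells of the restriction of f to P. *)
definition one_cells :: "cell set \<Rightarrow> (cell \<Rightarrow> nat) \<Rightarrow> cell set" where
  "one_cells P f = {c \<in> P. f c = 1}"

(* Fillings are extensional functions, so that distinct elements of this set differ on P. *)
definition fillings :: "cell set \<Rightarrow> (cell \<Rightarrow> nat) set" where
  "fillings P = {f \<in> P \<rightarrow>\<^sub>E {0, 1}. \<forall>y. card {c \<in> one_cells P f. snd c = y} \<le> 1}"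

definition nonempty_rows :: "cell set \<Rightarrow> (cell \<Rightarrow> nat) \<Rightarrow> int set" where
  "nonempty_rows P f = rows (one_cells P f)"

definition empty_rows :: "cell set \<Rightarrow> (cell \<Rightarrow> nat) \<Rightarrow> int set" where
  "empty_rows P f = rows P - nonempty_rows P f"

(* The list s is indexed from 0, so column c_(i+1) of P contains exactly s ! i ones. *)
definition fillings_with :: "cell set \<Rightarrow> nat list \<Rightarrow> int set \<Rightarrow> (cell \<Rightarrow> nat) set" where
  "fillings_with P s A = {f \<in> fillings P. empty_rows P f = A \<and>
     (\<forall>i < card (columns P).
        card {c \<in> one_cells P f. fst c = sorted_list_of_set (columns P) ! i} = s ! i)}"

(* The pair is ordered: a is the south-west cell of the chain and b the north-east one. *)
definition ne_chain :: "cell set \<Rightarrow> (cell \<Rightarrow> nat) \<Rightarrow> cell \<Rightarrow> cell \<Rightarrow> bool" where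
  "ne_chain P f a b \<longleftrightarrow> a \<in> one_cells P f \<and> b \<in> one_cells P f \<and>
     fst a < fst b \<and> snd a < snd b \<and> {fst a..fst b} \<times> {snd a..snd b} \<subseteq> P"

definition ne :: "cell set \<Rightarrow> (cell \<Rightarrow> nat) \<Rightarrow> nat" where
  "ne P f = card {(a, b). ne_chain P f a b}"

(* From top to bottom, that is, by decreasing y. *)
definition nonempty_row_list :: "cell set \<Rightarrow> (cell \<Rightarrow> nat) \<Rightarrow> int list" where
  "nonempty_row_list R f = rev (sorted_list_of_set (nonempty_rows R f))"

definition des :: "cell set \<Rightarrow> (cell \<Rightarrow> nat) \<Rightarrow> nat" where
  "des R f = card {i. Suc i < length (nonempty_row_list R f) \<and>
     (\<exists>a b. ne_chain R f a b \<and>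
        snd b = nonempty_row_list R f ! i \<and> snd a = nonempty_row_list R f ! Suc i)}"

(* In these functions R is a rectangle and the filling is the restriction of f to R.
   The set {c \<in> R. r \<le> snd c} consists of the row r of R and all rows above it. *)
definition maj_rectangle :: "cell set \<Rightarrow> (cell \<Rightarrow> nat) \<Rightarrow> nat" where
  "maj_rectangle R f = (\<Sum>r\<leftarrow>nonempty_row_list R f. des {c \<in> R. r \<le> snd c} f)"

definition rectangle :: "cell set \<Rightarrow> bool" where
  "rectangle R \<longleftrightarrow> (\<exists>a b c d. a \<le> b \<and> c \<le> d \<and> R = {a..b} \<times> {c..d})"

definition maximal_rectangles :: "cell set \<Rightarrow> cell set set" where
  "maximal_rectangles P = {R. rectangle R \<and> R \<subseteq> P \<and>
     (\<forall>R'. rectangle R' \<and> R' \<subseteq> P \<and> R \<subseteq> R' \<longrightarrow> R' = R)}"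

definition height :: "cell set \<Rightarrow> nat" where
  "height R = card (rows R)"

(* The maximal rectangles of a moon polyomino have pairwise distinct heights, because columns
   with the same number of cells occupy the same rows. Hence this list enumerates all of them. *)
definition rectangle_list :: "cell set \<Rightarrow> cell set list" where
  "rectangle_list P = sorted_key_list_of_set height (maximal_rectangles P)"

(* Integer-valued, so that the subtraction is not truncated. *)
definition maj :: "cell set \<Rightarrow> (cell \<Rightarrow> nat) \<Rightarrow> int" where
  "maj P f = (let Rs = rectangle_list P in
     (\<Sum>i<length Rs. int (maj_rectangle (Rs ! i) f))
     - (\<Sum>i<length Rs - 1. int (maj_rectangle (Rs ! i \<inter> Rs ! Suc i) f)))"

end

theory Submission
  imports Defs "HOL-Library.Sublist"
begin

text \<open>
  One of the two end columns of a moon polyomino is contained in every other column. If \<open>x\<close> is such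
  a column, with row set \<open>J\<close>, and \<open>C\<close> is the set of all columns, then removing \<open>x\<close> changes both
  statistics by the difference of their values on the rectangles \<open>C \<times> J\<close> and \<open>(C - {x}) \<times> J\<close>.
  Read as words from top to bottom, the fillings of these rectangles differ by the insertion of
  copies of a letter \<open>x\<close> that is larger or smaller than all others. When the copies are inserted
  into a word \<open>v\<close> in all possible ways, the changes of the inversion number and of the major index
  have the same distribution, the \<open>q\<close>-binomial coefficient, whatever \<open>v\<close> is. Since the nonempty
  rows through \<open>x\<close> are consecutive and interchangeable, the words left after the removal do not
  depend on where \<open>x\<close> was inserted, and induction on the columns applies.
\<close>

section \<open>Inserting an extremal letter into a word\<close>

text \<open>For a rectangle the theorem is MacMahon's equidistribution of inversions and major index
  on words of given content. No bijection between fillings is built: the effect of a single inserted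
  letter on the major index depends on its neighbours, and only its distribution over all insertions
  is controlled. This control, \<open>insertion_invariant\<close>, is all that the induction on
  columns uses about a statistic, so both statistics run through the same argument. That
  \<open>maj\<close> changes as simply as \<open>ne\<close> when a column is removed is due to the
  overlaps subtracted in its definition: the removal affects only the head of the list of maximal
  rectangles.\<close>

fun word_inv :: "int list \<Rightarrow> int" where
  "word_inv [] = 0"
| "word_inv (a # w) = word_inv w + int (length (filter (\<lambda>b. b < a) w))"

text \<open>A descent counts with the number of letters after it, that is, once for each of the longer
  prefixes whose descents are added up in \<open>maj_rectangle\<close>.\<close>

fun word_maj :: "int list \<Rightarrow> int" where
  "word_maj [] = 0"
| "word_maj [a] = 0"
| "word_maj (a # b # w) = word_maj (b # w) + (if b < a then int (Suc (length w)) else 0)"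

text \<open>The sum of \<open>h\<close> over the exponents of the \<open>q\<close>-binomial coefficient \<open>n + t\<close> over \<open>t\<close>. Testing
  against an arbitrary \<open>h\<close> in place of \<open>\<lambda>k. q ^ k\<close> avoids division by \<open>q\<close>.\<close>

fun qbinom_sum :: "nat \<Rightarrow> nat \<Rightarrow> (int \<Rightarrow> 'a::comm_monoid_add) \<Rightarrow> 'a" where
  "qbinom_sum 0 t h = h 0"
| "qbinom_sum (Suc n) 0 h = h 0"
| "qbinom_sum (Suc n) (Suc t) h =
     qbinom_sum (Suc n) t h + qbinom_sum n (Suc t) (\<lambda>k. h (k + int (Suc t)))"

lemma qbinom_sum_0_right [simp]: "qbinom_sum n 0 h = h 0"
  by (cases n) auto

text \<open>The second q-Pascal rule: the definition shifts one summand by \<open>t + 1\<close>,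
  this rule shifts the other by \<open>n + 1\<close>. Both are needed, because order relations
  between letters decide which class of words carries the shift.\<close>

lemma qbinom_sum_Suc_Suc':
  "qbinom_sum (Suc n) (Suc t) h =
     qbinom_sum n (Suc t) h + qbinom_sum (Suc n) t (\<lambda>k. h (k + int (Suc n)))"
proof (induction n arbitrary: t h)
  case 0
  show ?case
  proof (induction t arbitrary: h)
    case 0
    then show ?case by simp
  next
    case (Suc t)
    have "qbinom_sum (Suc 0) (Suc (Suc t)) h = qbinom_sum (Suc 0) (Suc t) h + h (int (Suc (Suc t)))"
      by simp
    also have "\<dots> = h 0 + (qbinom_sum (Suc 0) t (\<lambda>k. h (k + 1)) + h (int (Suc t) + 1))"
      by (subst Suc) (simp add: ac_simps)
    also have "\<dots> = h 0 + qbinom_sum (Suc 0) (Suc t) (\<lambda>k. h (k + 1))"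
      by simp
    finally show ?case by simp
  qed
next
  case (Suc n)
  note IHn = Suc
  show ?case
  proof (induction t arbitrary: h)
    case 0
    have "qbinom_sum (Suc (Suc n)) (Suc 0) h
        = h 0 + qbinom_sum (Suc n) (Suc 0) (\<lambda>k. h (k + 1))" by simp
    also have "\<dots> = (h 0 + qbinom_sum n (Suc 0) (\<lambda>k. h (k + 1))) + h (int (Suc (Suc n)))"
      by (subst IHn) (simp add: ac_simps)
    also have "\<dots> = qbinom_sum (Suc n) (Suc 0) h + h (int (Suc (Suc n)))"
      by simp
    finally show ?case by simp
  next
    case (Suc t)
    let ?h = "\<lambda>a k. h (k + int a)"
    have "qbinom_sum (Suc (Suc n)) (Suc (Suc t)) h =
        qbinom_sum (Suc (Suc n)) (Suc t) h + qbinom_sum (Suc n) (Suc (Suc t)) (?h (Suc (Suc t)))"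
      by (rule qbinom_sum.simps)
    also have "qbinom_sum (Suc (Suc n)) (Suc t) h =
        qbinom_sum (Suc n) (Suc t) h + qbinom_sum (Suc (Suc n)) t (?h (Suc (Suc n)))"
      by (rule Suc)
    \<comment> \<open>The total shift \<open>Suc n + Suc (Suc t)\<close> is written as
      \<open>Suc t + Suc (Suc n)\<close>, so that the four summands can be regrouped and folded by
      the defining rule.\<close>
    also have "qbinom_sum (Suc n) (Suc (Suc t)) (?h (Suc (Suc t))) =
        qbinom_sum n (Suc (Suc t)) (?h (Suc (Suc t)))
        + qbinom_sum (Suc n) (Suc t) (\<lambda>k. h (k + int (Suc t) + int (Suc (Suc n))))"
      by (subst IHn) (simp add: algebra_simps)
    also have "qbinom_sum (Suc n) (Suc t) h + qbinom_sum (Suc (Suc n)) t (?h (Suc (Suc n))) +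
       (qbinom_sum n (Suc (Suc t)) (?h (Suc (Suc t)))
        + qbinom_sum (Suc n) (Suc t) (\<lambda>k. h (k + int (Suc t) + int (Suc (Suc n))))) =
       (qbinom_sum (Suc n) (Suc t) h + qbinom_sum n (Suc (Suc t)) (?h (Suc (Suc t)))) +
       (qbinom_sum (Suc (Suc n)) t (?h (Suc (Suc n)))
        + qbinom_sum (Suc n) (Suc t) (\<lambda>k. h (k + int (Suc t) + int (Suc (Suc n)))))"
      by (simp only: ac_simps)
    also have "qbinom_sum (Suc n) (Suc t) h + qbinom_sum n (Suc (Suc t)) (?h (Suc (Suc t)))
       = qbinom_sum (Suc n) (Suc (Suc t)) h" by simp
    also have "qbinom_sum (Suc (Suc n)) t (?h (Suc (Suc n)))
        + qbinom_sum (Suc n) (Suc t) (\<lambda>k. h (k + int (Suc t) + int (Suc (Suc n))))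
       = qbinom_sum (Suc (Suc n)) (Suc t) (?h (Suc (Suc n)))" by simp
    finally show ?case .
  qed
qed

section \<open>Words obtained by inserting copies of a letter\<close>

definition insertions :: "int \<Rightarrow> int list \<Rightarrow> nat \<Rightarrow> int list set" where
  "insertions x v t = {u. filter (\<lambda>c. c \<noteq> x) u = v \<and> count_list u x = t}"

lemma insertions_Nil: "insertions x [] t = {replicate t x}"
proof -
  have count: "count_list (replicate n x) x = n" for n
    by (induction n) auto
  have "count_list u x = t \<longleftrightarrow> u = replicate t x" if "filter (\<lambda>c. c \<noteq> x) u = []" for u
  proof -
    have "u = replicate (length u) x"
      using that by (intro replicate_eqI) (auto simp: filter_empty_conv)
    then show ?thesis by (metis count length_replicate)
  qed
  moreover have "filter (\<lambda>c. c \<noteq> x) (replicate t x) = []" by simp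
  ultimately show ?thesis unfolding insertions_def by blast
qed

lemma insertions_0:
  assumes "x \<notin> set v" shows "insertions x v 0 = {v}"
proof -
  have "x \<notin> set u \<longleftrightarrow> filter (\<lambda>c. c \<noteq> x) u = u" for u
    by (auto simp: filter_id_conv)
  then show ?thesis using assms unfolding insertions_def
    by (auto simp: count_list_0_iff)
qed

lemma insertions_Cons_Suc:
  assumes "c \<noteq> x"
  shows "insertions x (c # v) (Suc t) =
    Cons x ` insertions x (c # v) t \<union> Cons c ` insertions x v (Suc t)"
proof (rule set_eqI)
  fix u
  show "u \<in> insertions x (c # v) (Suc t) \<longleftrightarrow>
     u \<in> Cons x ` insertions x (c # v) t \<union> Cons c ` insertions x v (Suc t)"
    using assms unfolding insertions_def by (cases u) auto
qed

lemma length_insertions: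
  "u \<in> insertions x v t \<Longrightarrow> length u = length v + t"
proof -
  have "length (filter (\<lambda>c. c \<noteq> x) u) + count_list u x = length u"
    by (induction u) auto
  then show "u \<in> insertions x v t \<Longrightarrow> length u = length v + t"
    unfolding insertions_def by auto
qed

lemma finite_insertions: "finite (insertions x v t)"
proof -
  have "insertions x v t \<subseteq> {u. set u \<subseteq> insert x (set v) \<and> length u = length v + t}"
    using length_insertions by (fastforce simp: insertions_def)
  then show ?thesis
    by (rule finite_subset) (simp add: finite_lists_length_eq)
qed

text \<open>The first letter is an inserted \<open>x\<close> or the old \<open>c\<close>; these two
  classes will match the two summands of a q-Pascal rule.\<close>

lemma sum_insertions_Cons_Suc:
  fixes g :: "int list \<Rightarrow> 'a::comm_monoid_add"
  assumes "c \<noteq> x"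
  shows "sum g (insertions x (c # v) (Suc t)) =
    (\<Sum>u\<in>insertions x (c # v) t. g (x # u)) + (\<Sum>u\<in>insertions x v (Suc t). g (c # u))"
  unfolding insertions_Cons_Suc[OF assms] using assms
  by (subst sum.union_disjoint) (auto simp: finite_insertions sum.reindex o_def)

lemma length_filter_insertions:
  assumes "u \<in> insertions x v t"
  shows "length (filter p u) = length (filter p v) + (if p x then t else 0)"
proof -
  have "length (filter p u) =
     length (filter p (filter (\<lambda>c. c \<noteq> x) u)) + (if p x then count_list u x else 0)"
    by (induction u) auto
  then show ?thesis using assms by (auto simp: insertions_def)
qed

definition extremal :: "int \<Rightarrow> int set \<Rightarrow> bool" where
  "extremal x C \<longleftrightarrow> (\<forall>c\<in>C. c < x) \<or> (\<forall>c\<in>C. x < c)"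

text \<open>The \<open>itself\<close> argument fixes the codomain of \<open>h\<close>, since a
  definition cannot quantify over types on its right-hand side.\<close>

definition insertion_invariant :: "(int list \<Rightarrow> int) \<Rightarrow> 'a::comm_monoid_add itself \<Rightarrow> bool" where
  "insertion_invariant st _ \<longleftrightarrow> (\<forall>x v t (h :: int \<Rightarrow> 'a). extremal x (set v) \<longrightarrow>
     (\<Sum>u\<in>insertions x v t. h (st u)) = qbinom_sum (length v) t (\<lambda>d. h (st v + d)))"

text \<open>A leading \<open>x\<close> is inverted with every old letter, and no inversion has
  \<open>x\<close> as its smaller letter. So only the \<open>x\<close>-first words are shifted, by
  the number of old letters, as in \<open>qbinom_sum_Suc_Suc'\<close>.\<close>

lemma sum_word_inv_insertions_max:
  fixes h :: "int \<Rightarrow> 'a::comm_monoid_add"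
  assumes "\<forall>c\<in>set v. c < x"
  shows "(\<Sum>u\<in>insertions x v t. h (word_inv u)) = qbinom_sum (length v) t (\<lambda>d. h (word_inv v + d))"
  using assms
proof (induction v arbitrary: t h)
  case Nil
  have "word_inv (replicate t x) = 0" by (induction t) auto
  then show ?case by (simp add: insertions_Nil)
next
  case (Cons c v)
  note IHv = Cons
  show ?case
  proof (induction t arbitrary: h)
    case 0
    have "x \<notin> set (c # v)" using Cons.prems by auto
    from insertions_0[OF this] show ?case by simp
  next
    case (Suc t)
    have A: "(\<Sum>u\<in>insertions x (c # v) t. h (word_inv (x # u))) =
        (\<Sum>u\<in>insertions x (c # v) t. h (word_inv u + int (Suc (length v))))"
    proof (intro sum.cong refl)
      fix u assume u: "u \<in> insertions x (c # v) t"
      have "length (filter (\<lambda>b. b < x) u) = Suc (length v)"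
        using length_filter_insertions[OF u, of "\<lambda>b. b < x"] Cons.prems
        by (simp cong: filter_cong)
      then show "h (word_inv (x # u)) = h (word_inv u + int (Suc (length v)))" by simp
    qed
    have B: "(\<Sum>u\<in>insertions x v (Suc t). h (word_inv (c # u))) =
        (\<Sum>u\<in>insertions x v (Suc t). h (word_inv u + int (length (filter (\<lambda>b. b < c) v))))"
      using length_filter_insertions Cons.prems by (intro sum.cong refl) fastforce
    have "c \<noteq> x" using Cons.prems by auto
    then show ?case
      unfolding sum_insertions_Cons_Suc[OF \<open>c \<noteq> x\<close>] A B length_Cons qbinom_sum_Suc_Suc'
      using Suc[of "\<lambda>k. h (k + int (Suc (length v)))"]
        IHv(1)[of "\<lambda>k. h (k + int (length (filter (\<lambda>b. b < c) v)))" "Suc t"] Cons.prems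
      by (simp add: algebra_simps)
  qed
qed

text \<open>Dual to the maximal case: a leading \<open>x\<close> causes no inversion, but the old
  first letter exceeds all \<open>Suc t\<close> copies of \<open>x\<close> behind it, which is the
  shift in the defining recursion of \<open>qbinom_sum\<close>.\<close>

lemma sum_word_inv_insertions_min:
  fixes h :: "int \<Rightarrow> 'a::comm_monoid_add"
  assumes "\<forall>c\<in>set v. x < c"
  shows "(\<Sum>u\<in>insertions x v t. h (word_inv u)) = qbinom_sum (length v) t (\<lambda>d. h (word_inv v + d))"
  using assms
proof (induction v arbitrary: t h)
  case Nil
  have "word_inv (replicate t x) = 0" by (induction t) auto
  then show ?case by (simp add: insertions_Nil)
next
  case (Cons c v)
  note IHv = Cons
  show ?case
  proof (induction t arbitrary: h)
    case 0
    have "x \<notin> set (c # v)" using Cons.prems by auto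
    from insertions_0[OF this] show ?case by simp
  next
    case (Suc t)
    have A: "(\<Sum>u\<in>insertions x (c # v) t. h (word_inv (x # u))) =
        (\<Sum>u\<in>insertions x (c # v) t. h (word_inv u))"
    proof (intro sum.cong refl)
      fix u assume u: "u \<in> insertions x (c # v) t"
      have "filter (\<lambda>b. b < x) (c # v) = []"
        using Cons.prems by (auto simp: filter_empty_conv)
      then have "length (filter (\<lambda>b. b < x) u) = 0"
        using length_filter_insertions[OF u, of "\<lambda>b. b < x"] by simp
      then show "h (word_inv (x # u)) = h (word_inv u)" by simp
    qed
    have B: "(\<Sum>u\<in>insertions x v (Suc t). h (word_inv (c # u))) = (\<Sum>u\<in>insertions x v (Suc t).
        h (word_inv u + int (length (filter (\<lambda>b. b < c) v)) + int (Suc t)))"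
      using length_filter_insertions Cons.prems by (intro sum.cong refl) (fastforce simp: algebra_simps)
    have "c \<noteq> x" using Cons.prems by auto
    then show ?case
      unfolding sum_insertions_Cons_Suc[OF \<open>c \<noteq> x\<close>] A B length_Cons qbinom_sum.simps
      using Suc[of h]
        IHv(1)[of "\<lambda>k. h (k + int (length (filter (\<lambda>b. b < c) v)) + int (Suc t))" "Suc t"] Cons.prems
      by (simp add: algebra_simps)
  qed
qed

section \<open>The major index under insertion\<close>

lemma word_maj_Cons_replicate:
  "word_maj (c # replicate t x) = (if x < c then int t else 0)"
proof (induction t arbitrary: c)
  case 0
  then show ?case by simp
next
  case (Suc t)
  from Suc[of x] show ?case by simp
qed

text \<open>Prepending a letter changes \<open>word_maj\<close> by an amount that depends on the old first letter, so
  the induction has to keep the sums for a fixed first letter apart.\<close>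

lemma sum_word_maj_insertions_max_aux:
  fixes h :: "int \<Rightarrow> 'a::comm_monoid_add"
  assumes "\<forall>c\<in>set v. c < x"
  shows "(\<Sum>u\<in>insertions x v t. h (word_maj (x # u)))
      = qbinom_sum (length v) t (\<lambda>d. h (word_maj v + int (length v) + d))"
    and "b < x \<Longrightarrow> (\<Sum>u\<in>insertions x v t. h (word_maj (b # u)))
      = qbinom_sum (length v) t (\<lambda>d. h (word_maj (b # v) + d))"
  using assms
proof (induction v arbitrary: t h b)
  case Nil
  { case 1 show ?case by (simp add: insertions_Nil word_maj_Cons_replicate) }
  { case 2 then show ?case by (simp add: insertions_Nil word_maj_Cons_replicate) }
next
  case (Cons c v)
  have cx: "c < x" if "\<forall>c\<in>set (c # v). c < x" using that by simp
  \<comment> \<open>Part (1) needs its own induction on \<open>t\<close>: behind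
    \<open>x # x\<close> the same \<open>c # v\<close> remains with one copy fewer. It is proved
    first because part (2) uses it for the words that continue \<open>b\<close> with
    \<open>x\<close>.\<close>
  have X: "(\<Sum>u\<in>insertions x (c # v) t. h (word_maj (x # u)))
      = qbinom_sum (length (c # v)) t (\<lambda>d. h (word_maj (c # v) + int (length (c # v)) + d))"
    if prems: "\<forall>c\<in>set (c # v). c < x" for t and h :: "int \<Rightarrow> 'a"
  proof (induction t arbitrary: h)
    case 0
    have "x \<notin> set (c # v)" using prems by auto
    from insertions_0[OF this] show ?case using prems by simp
  next
    case (Suc t)
    have B: "(\<Sum>u\<in>insertions x v (Suc t). h (word_maj (x # c # u))) =
        (\<Sum>u\<in>insertions x v (Suc t). h (word_maj (c # u) + int (length v + t) + 2))"
      using prems length_insertions by (intro sum.cong refl) (fastforce simp: algebra_simps)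
    have "c \<noteq> x" using prems by auto
    show ?case
      unfolding sum_insertions_Cons_Suc[OF \<open>c \<noteq> x\<close>] B
      using prems Suc[of h]
        Cons(2)[of c "\<lambda>k. h (k + int (length v + t) + 2)" "Suc t"]
      by (simp add: algebra_simps)
  qed
  { case 1 then show ?case by (rule X) }
  { case 2
    note prems = 2
    show ?case
    proof (cases t)
      case 0
      have "x \<notin> set (c # v)" using prems by auto
      from insertions_0[OF this] show ?thesis by (simp add: 0)
    next
      case (Suc t')
      have A: "(\<Sum>u\<in>insertions x (c # v) t'. h (word_maj (b # x # u))) =
        (\<Sum>u\<in>insertions x (c # v) t'. h (word_maj (x # u)))"
        using prems by simp
      have B: "(\<Sum>u\<in>insertions x v (Suc t'). h (word_maj (b # c # u))) =
        (\<Sum>u\<in>insertions x v (Suc t'). h (word_maj (c # u)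
            + (if c < b then int (length v + t') + 2 else 0)))"
        using prems length_insertions by (intro sum.cong refl) (fastforce simp: algebra_simps)
      have "c \<noteq> x" using prems by auto
      show ?thesis
      \<comment> \<open>Measured from \<open>word_maj (b # c # v)\<close>: for \<open>c < b\<close>
        this value already contains the descent weight \<open>length v + 1\<close>, so the
        \<open>x\<close>-first words are unshifted, and the \<open>c\<close>-first words shift by
        \<open>Suc t'\<close>, the number of letters added behind that descent. Otherwise the
        \<open>x\<close>-first words shift by \<open>length v + 1\<close>. This selects the Pascal
        rule.\<close>
      proof (cases "c < b")
        case True
        show ?thesis unfolding Suc sum_insertions_Cons_Suc[OF \<open>c \<noteq> x\<close>] A B length_Cons qbinom_sum.simps
          using prems X[of h t'] Cons(2)[of c "\<lambda>k. h (k + int (length v + t') + 2)" "Suc t'"] True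
          by (simp add: algebra_simps)
      next
        case False
        show ?thesis unfolding Suc sum_insertions_Cons_Suc[OF \<open>c \<noteq> x\<close>] A B length_Cons qbinom_sum_Suc_Suc'
          using prems X[of h t'] Cons(2)[of c h "Suc t'"] False
          by (simp add: algebra_simps)
      qed
    qed
  }
qed

lemma sum_word_maj_insertions_max:
  fixes h :: "int \<Rightarrow> 'a::comm_monoid_add"
  assumes "\<forall>c\<in>set v. c < x"
  shows "(\<Sum>u\<in>insertions x v t. h (word_maj u)) = qbinom_sum (length v) t (\<lambda>d. h (word_maj v + d))"
proof (cases v)
  case Nil
  have "word_maj (replicate t x) = 0"
    using word_maj_Cons_replicate[of x "t - 1" x] by (cases t) auto
  then show ?thesis by (simp add: insertions_Nil Nil)
next
  case (Cons c v')
  show ?thesis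
  proof (cases t)
    case 0
    have "x \<notin> set (c # v')" using assms Cons by auto
    from insertions_0[OF this] show ?thesis by (simp add: 0 Cons)
  next
    case (Suc t')
    show ?thesis
      unfolding Cons Suc length_Cons qbinom_sum_Suc_Suc'
      using assms sum_word_maj_insertions_max_aux(1)[of "c # v'" x h t']
        sum_word_maj_insertions_max_aux(2)[of v' x c h "Suc t'"]
      by (subst sum_insertions_Cons_Suc) (simp_all add: Cons algebra_simps)
  qed
qed

lemma word_maj_Cons_min:
  assumes "\<forall>c\<in>set u. x \<le> c" shows "word_maj (x # u) = word_maj u"
  using assms by (cases u) auto

text \<open>The offset \<open>int t\<close> in the second part is visible for \<open>v = []\<close>:
  the descent from \<open>b\<close> to the run of \<open>x\<close> has all \<open>t\<close> copies
  behind it. A leading minimal letter leaves \<open>word_maj\<close> unchanged, so words with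
  leading \<open>x\<close> reduce to the first part.\<close>

lemma sum_word_maj_insertions_min_aux:
  fixes h :: "int \<Rightarrow> 'a::comm_monoid_add"
  assumes "\<forall>c\<in>set v. x < c"
  shows "(\<Sum>u\<in>insertions x v t. h (word_maj u))
      = qbinom_sum (length v) t (\<lambda>d. h (word_maj v + d))"
    and "x < b \<Longrightarrow> (\<Sum>u\<in>insertions x v t. h (word_maj (b # u)))
      = qbinom_sum (length v) t (\<lambda>d. h (word_maj (b # v) + int t + d))"
  using assms
proof (induction v arbitrary: t h b)
  case Nil
  { case 1
    have "word_maj (replicate t x) = 0"
      using word_maj_Cons_replicate[of x "t - 1" x] by (cases t) auto
    then show ?case by (simp add: insertions_Nil) }
  { case 2 then show ?case by (simp add: insertions_Nil word_maj_Cons_replicate) }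
next
  case (Cons c v)
  have X: "word_maj (x # u) = word_maj u"
    if "\<forall>c\<in>set (c # v). x < c" "u \<in> insertions x (c # v) t" for u t
  proof (rule word_maj_Cons_min, rule ccontr)
    assume "\<not> (\<forall>a\<in>set u. x \<le> a)"
    then obtain a where "a \<in> set u" "a < x" by force
    then have "a \<in> set (filter (\<lambda>c. c \<noteq> x) u)" by auto
    then have "a \<in> set (c # v)" using that(2) unfolding insertions_def mem_Collect_eq by simp
    then show False using that(1) \<open>a < x\<close> by force
  qed
  have T: "(\<Sum>u\<in>insertions x (c # v) t. h (word_maj u))
      = qbinom_sum (length (c # v)) t (\<lambda>d. h (word_maj (c # v) + d))"
    if prems: "\<forall>c\<in>set (c # v). x < c" for t and h :: "int \<Rightarrow> 'a"
  proof (induction t arbitrary: h)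
    case 0
    have "x \<notin> set (c # v)" using prems by auto
    from insertions_0[OF this] show ?case using prems by simp
  next
    case (Suc t)
    have A: "(\<Sum>u\<in>insertions x (c # v) t. h (word_maj (x # u))) =
      (\<Sum>u\<in>insertions x (c # v) t. h (word_maj u))"
      using X[OF prems] by simp
    show ?case
      using prems Suc[of h] Cons(2)[of c h "Suc t"]
      by (subst sum_insertions_Cons_Suc) (simp_all add: A algebra_simps)
  qed
  { case 1 then show ?case by (rule T) }
  { case 2
    note prems = 2
    show ?case
    proof (cases t)
      case 0
      have "x \<notin> set (c # v)" using prems by auto
      from insertions_0[OF this] show ?thesis by (simp add: 0)
    next
      case (Suc t')
      have A: "(\<Sum>u\<in>insertions x (c # v) t'. h (word_maj (b # x # u))) =
        (\<Sum>u\<in>insertions x (c # v) t'. h (word_maj u + int (length v + t') + 2))"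
        using prems X[OF prems(2)] length_insertions
        by (intro sum.cong refl) (fastforce simp: algebra_simps)
      have B: "(\<Sum>u\<in>insertions x v (Suc t'). h (word_maj (b # c # u))) =
        (\<Sum>u\<in>insertions x v (Suc t'). h (word_maj (c # u)
            + (if c < b then int (length v + t') + 2 else 0)))"
        using prems length_insertions by (intro sum.cong refl) (fastforce simp: algebra_simps)
      have "c \<noteq> x" using prems by auto
      show ?thesis
      \<comment> \<open>Relative to the claimed base value, the \<open>c\<close>-first words shift
        by \<open>Suc t'\<close> if \<open>c < b\<close>, and the \<open>x\<close>-first words by
        \<open>length v + 1\<close> otherwise.\<close>
      proof (cases "c < b")
        case True
        show ?thesis unfolding Suc sum_insertions_Cons_Suc[OF \<open>c \<noteq> x\<close>] A B length_Cons qbinom_sum.simps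
          using prems T[of "\<lambda>k. h (k + int (length v + t') + 2)" t']
             Cons(2)[of c "\<lambda>k. h (k + int (length v + t') + 2)" "Suc t'"] True
          by (simp add: algebra_simps)
      next
        case False
        show ?thesis unfolding Suc sum_insertions_Cons_Suc[OF \<open>c \<noteq> x\<close>] A B length_Cons qbinom_sum_Suc_Suc'
          using prems T[of "\<lambda>k. h (k + int (length v + t') + 2)" t'] Cons(2)[of c h "Suc t'"] False
          by (simp add: algebra_simps)
      qed
    qed
  }
qed

lemma insertion_invariant_word_inv: "insertion_invariant word_inv TYPE('a::comm_monoid_add)"
  unfolding insertion_invariant_def extremal_def
  using sum_word_inv_insertions_max sum_word_inv_insertions_min by blast

lemma insertion_invariant_word_maj: "insertion_invariant word_maj TYPE('a::comm_monoid_add)"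
  unfolding insertion_invariant_def extremal_def
  using sum_word_maj_insertions_max sum_word_maj_insertions_min_aux(1) by blast

section \<open>Words in a shape\<close>

text \<open>\<open>Bs\<close> lists the column sets of the nonempty rows and \<open>w\<close> the columns of their 1-cells; \<open>block\<close>
  is the word of the rectangle with the columns \<open>C\<close> and the rows through \<open>x\<close>.\<close>

definition shape_words :: "int list \<Rightarrow> int set list \<Rightarrow> (int \<Rightarrow> nat) \<Rightarrow> int list set" where
  "shape_words xs Bs s = {w. list_all2 (\<in>) w Bs \<and> (\<forall>x\<in>set xs. count_list w x = s x)}"

definition block :: "int \<Rightarrow> int set \<Rightarrow> int set list \<Rightarrow> int list \<Rightarrow> int list" where
  "block x C Bs w = map snd (filter (\<lambda>(B, c). x \<in> B \<and> c \<in> C) (zip Bs w))"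

text \<open>\<open>Bs\<close> and \<open>w\<close> stay fixed along the recursion: letters of
  removed columns are masked by the column set passed to \<open>block\<close> instead of being
  deleted.\<close>

fun word_stat :: "(int list \<Rightarrow> int) \<Rightarrow> int list \<Rightarrow> int set list \<Rightarrow> int list \<Rightarrow> int" where
  "word_stat st [] Bs w = 0"
| "word_stat st (x # xs) Bs w =
     word_stat st xs Bs w + st (block x (set (x # xs)) Bs w) - st (block x (set xs) Bs w)"

fun removal_order :: "int list \<Rightarrow> bool" where
  "removal_order [] \<longleftrightarrow> True"
| "removal_order (x # xs) \<longleftrightarrow> extremal x (set xs) \<and> removal_order xs"

text \<open>In the list of columns in their order of removal, a row occupies a final segment: once one of
  its columns is the next to be removed, it contains all the remaining ones.\<close>

fun upper_part :: "int list \<Rightarrow> int set \<Rightarrow> bool" where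
  "upper_part [] B \<longleftrightarrow> B = {}"
| "upper_part (x # xs) B \<longleftrightarrow> (x \<in> B \<longrightarrow> B = set (x # xs)) \<and> upper_part xs (B - {x})"

text \<open>Column convexity, phrased without row coordinates so that it survives the deletion of
  rows and of a column.\<close>

definition unimodal :: "int set list \<Rightarrow> bool" where
  "unimodal Bs \<longleftrightarrow> (\<forall>B1 B2 B3. subseq [B1, B2, B3] Bs \<longrightarrow> B1 \<inter> B3 \<subseteq> B2)"

lemma extremal_not_in: "extremal x C \<Longrightarrow> x \<notin> C"
  unfolding extremal_def by auto

lemma extremal_subset: "extremal x C \<Longrightarrow> D \<subseteq> C \<Longrightarrow> extremal x D"
  unfolding extremal_def by auto

lemma block_append:
  "length p = length Bs \<Longrightarrow> block x C (Bs @ Cs) (p @ q) = block x C Bs p @ block x C Cs q"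
  by (simp add: block_def)

lemma block_replicate: "x \<in> B \<Longrightarrow> block x C (replicate (length u) B) u = filter (\<lambda>c. c \<in> C) u"
  by (induction u) (auto simp: block_def)

lemma block_empty: "\<forall>B\<in>set Bs. x \<notin> B \<Longrightarrow> block x C Bs w = []"
  by (auto simp: block_def filter_empty_conv dest: set_zip_leftD)

lemma block_map_minus: "y \<noteq> x \<Longrightarrow> block y C (map (\<lambda>B. B - {x}) Bs) w = block y C Bs w"
proof (induction Bs arbitrary: w)
  case (Cons B Bs)
  then show ?case by (cases w) (auto simp: block_def)
qed (simp add: block_def)

text \<open>\<open>word_stat st xs\<close> sees only blocks whose column and column set come from
  \<open>xs\<close>. This allows a removed column to be dropped from the rows, and its letters with
  their rows from the word.\<close>

lemma word_stat_cong:
  assumes "\<And>y C. y \<in> set xs \<Longrightarrow> C \<subseteq> set xs \<Longrightarrow> block y C Bs w = block y C Bs' w'"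
  shows "word_stat st xs Bs w = word_stat st xs Bs' w'"
  using assms
proof (induction xs)
  case (Cons x xs)
  have "word_stat st xs Bs w = word_stat st xs Bs' w'"
    by (intro Cons.IH Cons.prems) auto
  moreover have "block x (set (x # xs)) Bs w = block x (set (x # xs)) Bs' w'"
    "block x (set xs) Bs w = block x (set xs) Bs' w'"
    by (intro Cons.prems; auto)+
  ultimately show ?case by simp
qed simp

text \<open>A row without \<open>x\<close> between two rows with \<open>x\<close> would contradict
  unimodality, so the rows through \<open>x\<close> form one run; as all of them equal
  \<open>S\<close>, the run is a \<open>replicate\<close>.\<close>

lemma unimodal_split:
  assumes "unimodal Bs" "\<forall>B\<in>set Bs. x \<in> B \<longrightarrow> B = S"
  obtains pre n post where "Bs = pre @ replicate n S @ post"
    "\<forall>B\<in>set pre. x \<notin> B" "\<forall>B\<in>set post. x \<notin> B"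
proof -
  define pre rest mid post where
    "pre = takeWhile (\<lambda>B. x \<notin> B) Bs" and "rest = dropWhile (\<lambda>B. x \<notin> B) Bs"
    and "mid = takeWhile (\<lambda>B. x \<in> B) rest" and "post = dropWhile (\<lambda>B. x \<in> B) rest"
  have Bs: "Bs = pre @ mid @ post"
    by (simp add: pre_def rest_def mid_def post_def)
  have mid_in: "\<forall>B\<in>set mid. x \<in> B" unfolding mid_def by (auto dest: set_takeWhileD)
  have "mid = replicate (length mid) S"
    by (rule replicate_eqI) (use Bs assms(2) mid_in in auto)
  moreover have "\<forall>B\<in>set pre. x \<notin> B" unfolding pre_def by (auto dest: set_takeWhileD)
  moreover have "\<forall>B\<in>set post. x \<notin> B"
  proof (rule ccontr)
    assume "\<not> ?thesis"
    then obtain B3 where B3: "B3 \<in> set post" "x \<in> B3" by auto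
    then have "post \<noteq> []" by auto
    then obtain B2 post' where post: "post = B2 # post'" by (cases post) auto
    have B2: "x \<notin> B2" using hd_dropWhile[of "\<lambda>B. x \<in> B" rest] post unfolding post_def by auto
    have "rest \<noteq> []" using post unfolding post_def by auto
    then have "x \<in> hd rest" using hd_dropWhile[of "\<lambda>B. x \<notin> B" Bs] unfolding rest_def by auto
    then obtain B1 mid' where mid: "mid = B1 # mid'"
      using \<open>rest \<noteq> []\<close> unfolding mid_def by (cases rest) auto
    have "B3 \<in> set post'" using B3 B2 post by auto
    then obtain r1 r2 where "post' = r1 @ B3 # r2" by (meson split_list)
    then have "Bs = pre @ [B1] @ mid' @ [B2] @ r1 @ [B3] @ r2"
      using Bs mid post by simp
    moreover have "subseq ([] @ [B1] @ [] @ [B2] @ [] @ [B3] @ [])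
        (pre @ [B1] @ mid' @ [B2] @ r1 @ [B3] @ r2)"
      by (intro list_emb_append_mono) auto
    ultimately have "subseq [B1, B2, B3] Bs" by simp
    then have "B1 \<inter> B3 \<subseteq> B2" using assms(1) unfolding unimodal_def by blast
    moreover have "x \<in> B1" using mid mid_in by simp
    ultimately show False using B2 B3 by auto
  qed
  ultimately show ?thesis
    using that[of pre "length mid" post] Bs by simp
qed

lemma unimodal_subseq: "unimodal Bs \<Longrightarrow> subseq Cs Bs \<Longrightarrow> unimodal Cs"
  unfolding unimodal_def using subseq_order.order_trans by blast

lemma unimodal_map_minus: "unimodal Bs \<Longrightarrow> unimodal (map (\<lambda>B. B - {x}) Bs)"
  unfolding unimodal_def
proof (intro allI impI)
  fix B1 B2 B3
  assume unim: "\<forall>B1 B2 B3. subseq [B1, B2, B3] Bs \<longrightarrow> B1 \<inter> B3 \<subseteq> B2"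
    and "subseq [B1, B2, B3] (map (\<lambda>B. B - {x}) Bs)"
  then obtain N where "[B1, B2, B3] = nths (map (\<lambda>B. B - {x}) Bs) N"
    unfolding subseq_conv_nths by blast
  then have eq: "[B1, B2, B3] = map (\<lambda>B. B - {x}) (nths Bs N)" by (simp add: nths_map)
  then obtain C1 C2 C3 where C: "nths Bs N = [C1, C2, C3]"
    by (auto simp: Cons_eq_map_conv)
  then have "subseq [C1, C2, C3] Bs" by (metis subseq_conv_nths)
  then have "C1 \<inter> C3 \<subseteq> C2" using unim by blast
  then show "B1 \<inter> B3 \<subseteq> B2" using eq C by auto
qed

lemma subseq_replicate: "k \<le> n \<Longrightarrow> subseq (replicate k a) (replicate n a)"
  by (metis le_add_diff_inverse replicate_add subseq_rev_drop_many subseq_order.order_refl list_emb_append2 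
      list_emb_prefix)

lemma count_list_filter: "count_list (filter P u) y = (if P y then count_list u y else 0)"
  by (induction u) auto

lemma upper_part_subset: "upper_part xs B \<Longrightarrow> B \<subseteq> set xs"
proof (induction xs arbitrary: B)
  case (Cons x xs)
  then have "B - {x} \<subseteq> set xs" by simp
  then show ?case by auto
qed simp

text \<open>The letter \<open>x\<close> can occur only in the middle run of \<open>n\<close> full
  rows. Deleting its \<open>s x\<close> copies leaves a segment that fits any \<open>n - s x\<close>
  of these rows, so one smaller shape \<open>Bs'\<close> serves for all positions of
  \<open>x\<close>.\<close>

lemma sum_word_stat_Cons:
  fixes h :: "int \<Rightarrow> 'a::comm_monoid_add"
  assumes st: "insertion_invariant st TYPE('a)"
    and ext: "extremal x (set xs)"
    and pre: "\<forall>B\<in>set pre. x \<notin> B" and post: "\<forall>B\<in>set post. x \<notin> B"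
    and sub: "\<Union>(set (pre @ post)) \<subseteq> set xs"
    and sx: "s x \<le> n"
  defines "Bs \<equiv> pre @ replicate n (set (x # xs)) @ post"
    and "Bs' \<equiv> map (\<lambda>B. B - {x}) (pre @ replicate (n - s x) (set (x # xs)) @ post)"
  shows "(\<Sum>w\<in>shape_words (x # xs) Bs s. h (word_stat st (x # xs) Bs w)) =
    (\<Sum>w\<in>shape_words xs Bs' s. qbinom_sum (n - s x) (s x) (\<lambda>d. h (word_stat st xs Bs' w + d)))"
proof -
  define a b t where "a = length pre" and "b = length post" and "t = s x"
  have x_notin: "x \<notin> set xs" using ext by (rule extremal_not_in)
  have all2_minus: "list_all2 (\<in>) p (map (\<lambda>B. B - {x}) Cs) \<longleftrightarrow> list_all2 (\<in>) p Cs \<and> x \<notin> set p"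
    for p Cs by (induction p Cs rule: list_induct2') auto
  have not_in: "x \<notin> set p" if "list_all2 (\<in>) p Cs" "\<forall>B\<in>set Cs. x \<notin> B" for p Cs
    using that by (induction rule: list_all2_induct) auto
  have all2_rep: "list_all2 (\<in>) u (replicate (length u) B) \<longleftrightarrow> set u \<subseteq> B" for u :: "int list" and B
    by (induction u) auto
  have mem1: "p @ u @ z \<in> shape_words (x # xs) Bs s \<longleftrightarrow>
      list_all2 (\<in>) p pre \<and> set u \<subseteq> insert x (set xs) \<and> list_all2 (\<in>) z post \<and> count_list u x = t \<and>
      (\<forall>y\<in>set xs. count_list (p @ u @ z) y = s y)"
    if "length p = a" "length u = n" "length z = b" for p u z
  proof -
    have "list_all2 (\<in>) (p @ u @ z) Bs \<longleftrightarrow>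
        list_all2 (\<in>) p pre \<and> set u \<subseteq> insert x (set xs) \<and> list_all2 (\<in>) z post"
      using that all2_rep[of u] by (simp add: Bs_def a_def b_def list_all2_append)
    moreover have "count_list (p @ u @ z) x = count_list u x"
      if "list_all2 (\<in>) p pre" "list_all2 (\<in>) z post"
      using not_in[OF that(1) pre] not_in[OF that(2) post] by (simp add: count_list_0_iff)
    ultimately show ?thesis by (auto simp: shape_words_def t_def simp del: count_list_append)
  qed
  have mem2: "p @ v @ z \<in> shape_words xs Bs' s \<longleftrightarrow>
      list_all2 (\<in>) p pre \<and> set v \<subseteq> set xs \<and> list_all2 (\<in>) z post \<and>
      (\<forall>y\<in>set xs. count_list (p @ v @ z) y = s y)"
    if "length p = a" "length v = n - t" "length z = b" for p v z
  proof -
    have "list_all2 (\<in>) (p @ v @ z) Bs' \<longleftrightarrow>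
        list_all2 (\<in>) p pre \<and> set v \<subseteq> set xs \<and> list_all2 (\<in>) z post"
      using that all2_rep[of v "insert x (set xs)"] x_notin not_in[OF _ pre] not_in[OF _ post]
      by (auto simp: Bs'_def a_def b_def t_def list_all2_append all2_minus simp del: map_replicate map_append)
    then show ?thesis by (auto simp: shape_words_def)
  qed
  have dec1: "\<exists>p u z. w = p @ u @ z \<and> length p = a \<and> length u = n \<and> length z = b"
    if "w \<in> shape_words (x # xs) Bs s" for w
  proof -
    have "length w = a + n + b"
      using that by (auto simp: shape_words_def Bs_def a_def b_def dest: list_all2_lengthD)
    then have "w = take a w @ take n (drop a w) @ drop n (drop a w) \<and> length (take a w) = a \<and>
        length (take n (drop a w)) = n \<and> length (drop n (drop a w)) = b"
      by (simp del: drop_drop)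
    then show ?thesis by blast
  qed
  have dec2: "\<exists>p v z. w = p @ v @ z \<and> length p = a \<and> length v = n - t \<and> length z = b"
    if "w \<in> shape_words xs Bs' s" for w
  proof -
    have "length w = a + (n - t) + b"
      using that by (auto simp: shape_words_def Bs'_def a_def b_def t_def dest: list_all2_lengthD)
    then have "w = take a w @ take (n - t) (drop a w) @ drop (n - t) (drop a w) \<and> length (take a w) = a \<and>
        length (take (n - t) (drop a w)) = n - t \<and> length (drop (n - t) (drop a w)) = b"
      by (simp del: drop_drop)
    then show ?thesis by blast
  qed
  \<comment> \<open>\<open>Sig\<close> pairs a word of the smaller shape with a way to reinsert the
    copies of \<open>x\<close> into its middle segment; \<open>F\<close> performs the insertion, and
    \<open>G\<close> undoes it while recording the full segment.\<close>
  define mid where "mid w = take (n - t) (drop a w)" for w :: "int list"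
  define Sig where "Sig = Sigma (shape_words xs Bs' s) (\<lambda>w. insertions x (mid w) t)"
  define F where "F = (\<lambda>(w, u). take a w @ u @ drop (a + (n - t)) (w :: int list))"
  define G where "G w = (take a w @ filter (\<lambda>c. c \<noteq> x) (take n (drop a w)) @ drop (a + n) w,
      take n (drop a (w :: int list)))" for w
  have Sig_iff: "(p @ v @ z, u) \<in> Sig \<longleftrightarrow> p @ v @ z \<in> shape_words xs Bs' s \<and> u \<in> insertions x v t"
    if "length p = a" "length v = n - t" for p v z u
    using that by (simp add: Sig_def mid_def)
  have len_filter: "length (filter (\<lambda>c. c \<noteq> x) u) = n - t"
    if "count_list u x = t" "length u = n" for u
    using that length_insertions[of u x "filter (\<lambda>c. c \<noteq> x) u" t] by (simp add: insertions_def)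
  have main: "(p @ filter (\<lambda>c. c \<noteq> x) u @ z, u) \<in> Sig \<longleftrightarrow> p @ u @ z \<in> shape_words (x # xs) Bs s"
    if "length p = a" "length u = n" "length z = b" "count_list u x = t" for p u z
  proof -
    have "set (filter (\<lambda>c. c \<noteq> x) u) \<subseteq> set xs \<longleftrightarrow> set u \<subseteq> insert x (set xs)" by auto
    moreover have "(\<forall>y\<in>set xs. count_list (p @ filter (\<lambda>c. c \<noteq> x) u @ z) y = s y) \<longleftrightarrow>
       (\<forall>y\<in>set xs. count_list (p @ u @ z) y = s y)"
      using x_notin by (auto simp: count_list_filter)
    ultimately show ?thesis
      using that len_filter[of u]
      by (simp add: Sig_iff mem1 mem2 insertions_def del: count_list_append set_filter)
  qed
  \<comment> \<open>Only the head summand of \<open>word_stat\<close> sees \<open>x\<close>: its two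
    blocks are \<open>u\<close> and \<open>v\<close>. All other blocks agree because their column
    sets omit \<open>x\<close>.\<close>
  have stat: "word_stat st (x # xs) Bs (p @ u @ z) =
      word_stat st xs Bs' (p @ v @ z) - st v + st u"
    if "length p = a" "length v = n - t" "length u = n" "length z = b" "u \<in> insertions x v t"
      "p @ v @ z \<in> shape_words xs Bs' s" for p u v z
  proof -
    have v: "v = filter (\<lambda>c. c \<noteq> x) u" using that(5) by (simp add: insertions_def)
    have sv: "set v \<subseteq> set xs" using that mem2[of p v z] by simp
    then have su: "set u \<subseteq> insert x (set xs)" unfolding v by auto
    have bl: "block y C Bs (p @ u @ z)
        = block y C pre p @ block y C (replicate (length u) (set (x # xs))) u @ block y C post z"
      for y C using that unfolding Bs_def by (simp add: block_append a_def b_def)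
    have bl': "block y C Bs' (p @ v @ z)
        = block y C (map (\<lambda>B. B - {x}) pre) p
        @ block y C (map (\<lambda>B. B - {x}) (replicate (length v) (set (x # xs)))) v
        @ block y C (map (\<lambda>B. B - {x}) post) z"
      for y C using that unfolding Bs'_def map_append by (simp add: block_append a_def b_def t_def)
    have "block x (set (x # xs)) Bs (p @ u @ z) = u"
      unfolding bl using pre post su
      by (subst block_replicate) (auto simp: block_empty filter_id_conv)
    moreover have "block x (set xs) Bs (p @ u @ z) = v"
      unfolding bl v using pre post su x_notin
      by (subst block_replicate) (auto simp: block_empty intro!: filter_cong)
    moreover have "word_stat st xs Bs (p @ u @ z) = word_stat st xs Bs' (p @ v @ z)"
    proof (rule word_stat_cong)
      fix y C assume y: "y \<in> set xs" and C: "C \<subseteq> set xs"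
      have "y \<noteq> x" using y x_notin by auto
      moreover have "filter (\<lambda>c. c \<in> C) u = filter (\<lambda>c. c \<in> C) v"
        unfolding v filter_filter using C x_notin by (intro filter_cong) auto
      ultimately show "block y C Bs (p @ u @ z) = block y C Bs' (p @ v @ z)"
        unfolding bl bl' using y by (simp add: block_map_minus block_replicate del: map_replicate)
    qed
    ultimately show ?thesis by simp
  qed
  have "(\<Sum>w\<in>shape_words (x # xs) Bs s. h (word_stat st (x # xs) Bs w)) =
      (\<Sum>(w, u)\<in>Sig. h (word_stat st xs Bs' w - st (mid w) + st u))"
  proof (rule sum.reindex_bij_witness[of _ F G])
    fix w assume w: "w \<in> shape_words (x # xs) Bs s"
    from dec1[OF this] obtain p u z where w_eq: "w = p @ u @ z"
      and len: "length p = a" "length u = n" "length z = b" by blast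
    have cu: "count_list u x = t" using w mem1[OF len] unfolding w_eq by blast
    let ?v = "filter (\<lambda>c. c \<noteq> x) u"
    have G: "G w = (p @ ?v @ z, u)" using len by (simp add: G_def w_eq)
    have lv: "length ?v = n - t" using len_filter cu len by simp
    show "F (G w) = w" unfolding G using len lv by (simp add: F_def w_eq)
    have Gin: "(p @ ?v @ z, u) \<in> Sig" using main[OF len cu] w unfolding w_eq by blast
    then show "G w \<in> Sig" unfolding G .
    have "u \<in> insertions x ?v t" "p @ ?v @ z \<in> shape_words xs Bs' s"
      using Gin Sig_iff[OF len(1) lv] by auto
    then show "(case G w of (w, u) \<Rightarrow> h (word_stat st xs Bs' w - st (mid w) + st u))
        = h (word_stat st (x # xs) Bs w)"
      using stat[of p ?v u z] len lv unfolding G unfolding w_eq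
      by (simp add: mid_def del: word_stat.simps)
  next
    fix wu assume wu: "wu \<in> Sig"
    obtain w u where wu_eq: "wu = (w, u)" by fastforce
    have "w \<in> shape_words xs Bs' s" using wu unfolding wu_eq Sig_def by simp
    from dec2[OF this] obtain p v z where w_eq: "w = p @ v @ z"
      and len: "length p = a" "length v = n - t" "length z = b" by blast
    have u: "u \<in> insertions x v t" using wu unfolding wu_eq w_eq Sig_iff[OF len(1,2)] by blast
    then have v: "v = filter (\<lambda>c. c \<noteq> x) u" and cu: "count_list u x = t"
      by (auto simp: insertions_def)
    have lu: "length u = n" using length_insertions[OF u] len sx by (simp add: t_def)
    have F: "F wu = p @ u @ z" using len by (simp add: F_def wu_eq w_eq)
    show "G (F wu) = wu" unfolding F using len lu by (simp add: G_def wu_eq w_eq flip: v)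
    show "F wu \<in> shape_words (x # xs) Bs s"
      unfolding F using wu main[OF len(1) lu len(3) cu] unfolding wu_eq w_eq v by blast
  qed
  also have "\<dots> = (\<Sum>w\<in>shape_words xs Bs' s. \<Sum>u\<in>insertions x (mid w) t.
      h (word_stat st xs Bs' w - st (mid w) + st u))"
  proof -
    have "finite (shape_words xs Bs' s)"
    proof (rule finite_subset)
      have "B \<subseteq> set xs" if "B \<in> set Bs'" for B
        using that sub unfolding Bs'_def by (auto split: if_splits)
      then show "shape_words xs Bs' s \<subseteq> {w. set w \<subseteq> set xs \<and> length w = length Bs'}"
        by (auto simp: shape_words_def list_all2_conv_all_nth in_set_conv_nth)
          (metis nth_mem subsetD in_set_conv_nth)
    qed (simp add: finite_lists_length_eq)
    then show ?thesis unfolding Sig_def by (subst sum.Sigma) (auto simp: finite_insertions)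
  qed
  also have "\<dots> = (\<Sum>w\<in>shape_words xs Bs' s.
      qbinom_sum (n - s x) (s x) (\<lambda>d. h (word_stat st xs Bs' w + d)))"
  proof (intro sum.cong refl)
    fix w assume w: "w \<in> shape_words xs Bs' s"
    from dec2[OF this] obtain p v z where w_eq: "w = p @ v @ z"
      and len: "length p = a" "length v = n - t" "length z = b" by blast
    have mid: "mid w = v" using len by (simp add: mid_def w_eq)
    have "set v \<subseteq> set xs" using w mem2[OF len] unfolding w_eq by blast
    then have "extremal x (set v)" using ext extremal_subset by blast
    then show "(\<Sum>u\<in>insertions x (mid w) t. h (word_stat st xs Bs' w - st (mid w) + st u)) =
        qbinom_sum (n - s x) (s x) (\<lambda>d. h (word_stat st xs Bs' w + d))"
      \<comment> \<open>The test function is shifted by \<open>word_stat st xs Bs' w - st v\<close>,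
        so that the base value \<open>st v\<close> in the invariance cancels.\<close>
      using st[unfolded insertion_invariant_def, rule_format,
          of x v "\<lambda>k. h (word_stat st xs Bs' w - st v + k)" t] len
      unfolding mid by (simp add: t_def algebra_simps)
  qed
  finally show ?thesis .
qed

lemma sum_word_stat_eq:
  fixes h :: "int \<Rightarrow> 'a::comm_monoid_add"
  assumes st: "insertion_invariant st1 TYPE('a)" "insertion_invariant st2 TYPE('a)"
    and "removal_order xs" "\<forall>B\<in>set Bs. upper_part xs B" "unimodal Bs"
  shows "(\<Sum>w\<in>shape_words xs Bs s. h (word_stat st1 xs Bs w)) =
    (\<Sum>w\<in>shape_words xs Bs s. h (word_stat st2 xs Bs w))"
  using assms(3-)
proof (induction xs arbitrary: Bs h)
  case (Cons x xs)
  have "\<forall>B\<in>set Bs. x \<in> B \<longrightarrow> B = set (x # xs)" using Cons.prems by simp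
  from unimodal_split[OF Cons.prems(3) this] obtain pre n post where
    Bs: "Bs = pre @ replicate n (set (x # xs)) @ post"
    and pre: "\<forall>B\<in>set pre. x \<notin> B" and post: "\<forall>B\<in>set post. x \<notin> B" by metis
  have ext: "extremal x (set xs)" using Cons.prems by simp
  have sub: "\<Union>(set (pre @ post)) \<subseteq> set xs"
    proof
    fix y assume "y \<in> \<Union>(set (pre @ post))"
    then obtain B where B: "B \<in> set pre \<union> set post" "y \<in> B" by auto
    then have "upper_part (x # xs) B" using Cons.prems(2) Bs by auto
    from upper_part_subset[OF this] show "y \<in> set xs" using B pre post by auto
  qed
  note step = sum_word_stat_Cons[where pre = pre and post = post and n = n and s = s,
      OF _ ext pre post sub]
  show ?case
  proof (cases "s x \<le> n")
    case True
    let ?Cs = "pre @ replicate (n - s x) (set (x # xs)) @ post"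
    let ?Bs = "map (\<lambda>B. B - {x}) ?Cs"
    have sub': "subseq ?Cs Bs" unfolding Bs
      by (intro list_emb_append_mono subseq_replicate) auto
    have "unimodal ?Bs" using unimodal_subseq[OF Cons.prems(3) sub'] by (rule unimodal_map_minus)
    moreover have "\<forall>B\<in>set ?Bs. upper_part xs B"
    proof -
      have "set ?Cs \<subseteq> set Bs" using Bs by auto
      then show ?thesis using Cons.prems(2) by (auto simp del: set_append map_append)
    qed
    ultimately show ?thesis
      unfolding Bs step[OF st(1) True] step[OF st(2) True]
      \<comment> \<open>The induction hypothesis is applied to a q-binomial sum as test function,
        which is why \<open>h\<close> is arbitrary in the induction. This sum depends on
        \<open>n\<close> and \<open>s x\<close> but not on the statistic.\<close>
      using Cons.IH[where Bs = ?Bs and h = "\<lambda>k. qbinom_sum (n - s x) (s x) (\<lambda>d. h (k + d))"]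
        Cons.prems(1) by simp
  next
    case False
    have "shape_words (x # xs) Bs s = {}"
    proof (rule ccontr)
      assume "shape_words (x # xs) Bs s \<noteq> {}"
      then obtain w where w: "list_all2 (\<in>) w Bs" "count_list w x = s x"
        by (auto simp: shape_words_def)
      have "count_list w x \<le> length (filter (\<lambda>B. x \<in> B) Bs)"
        using w(1) by (induction rule: list_all2_induct) auto
      also have "\<dots> \<le> n" unfolding Bs using pre post by (simp add: filter_empty_conv)
      finally show False using w False by simp
    qed
    then show ?thesis by simp
  qed
qed simp

section \<open>The statistics on rectangles\<close>

definition word_des :: "int list \<Rightarrow> nat" where
  "word_des w = card {i. Suc i < length w \<and> w ! Suc i < w ! i}"

lemma word_des_Cons_Cons: "word_des (a # b # w) = of_bool (b < a) + word_des (b # w)"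
proof -
  have eq: "{i. Suc i < length (a # b # w) \<and> (a # b # w) ! Suc i < (a # b # w) ! i} =
      (if b < a then {0} else {}) \<union> Suc ` {i. Suc i < length (b # w) \<and> (b # w) ! Suc i < (b # w) ! i}"
    (is "?A = ?B \<union> Suc ` ?C")
  proof (rule set_eqI)
    show "i \<in> ?A \<longleftrightarrow> i \<in> ?B \<union> Suc ` ?C" for i by (cases i) auto
  qed
  have "finite ?C" by (rule finite_subset[of _ "{..<length (b # w)}"]) auto
  then have "card (?B \<union> Suc ` ?C) = card ?B + card ?C"
    by (subst card_Un_disjoint) (auto simp: card_image)
  then show ?thesis unfolding word_des_def eq by simp
qed

text \<open>On a decreasing list, filtering by \<open>r \<le> y\<close> yields the prefix ending at
  \<open>r\<close>, so the left side adds up the descents of all prefixes.\<close>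

lemma sum_word_des_eq_word_maj:
  fixes g :: "int \<Rightarrow> int"
  assumes "sorted_wrt (>) ys"
  shows "int (\<Sum>r\<leftarrow>ys. word_des (map g (filter (\<lambda>y. r \<le> y) ys))) = word_maj (map g ys)"
  using assms
proof (induction ys)
  case (Cons z zs)
  have z: "filter (\<lambda>y. z \<le> y) zs = []"
    using Cons.prems by (auto simp: filter_empty_conv)
  have 0: "word_des [a] = 0" for a by (simp add: word_des_def)
  show ?case
  proof (cases zs)
    case Nil
    then show ?thesis by (simp add: 0)
  next
    case (Cons y ys)
    \<comment> \<open>Each prefix ending at an entry of \<open>zs\<close> contains the first two
      entries \<open>z\<close> and \<open>y\<close>, so the descent between them is counted
      \<open>length zs\<close> times.\<close>
    have "map (\<lambda>r. word_des (map g (filter ((\<le>) r) (z # zs)))) zs =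
        map (\<lambda>r. of_bool (g y < g z) + word_des (map g (filter ((\<le>) r) zs))) zs"
    proof (rule map_cong[OF refl])
      fix r assume "r \<in> set zs"
      then have "r \<le> y" "r \<le> z" using Cons.prems Cons by (auto intro: less_imp_le)
      then show "word_des (map g (filter ((\<le>) r) (z # zs))) =
          of_bool (g y < g z) + word_des (map g (filter ((\<le>) r) zs))"
        by (simp add: Cons word_des_Cons_Cons)
    qed
    then have "(\<Sum>r\<leftarrow>zs. word_des (map g (filter ((\<le>) r) (z # zs)))) =
        length zs * of_bool (g y < g z) + (\<Sum>r\<leftarrow>zs. word_des (map g (filter ((\<le>) r) zs)))"
      by (simp only: sum_list_addf sum_list_triv of_nat_id)
    moreover have "int (\<Sum>r\<leftarrow>zs. word_des (map g (filter ((\<le>) r) zs))) = word_maj (map g zs)"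
      using Cons.IH Cons.prems by simp
    ultimately have "int (\<Sum>r\<leftarrow>zs. word_des (map g (filter ((\<le>) r) (z # zs)))) =
        word_maj (map g (z # zs))"
      using Cons by simp
    then show ?thesis using z by (simp add: 0)
  qed
qed simp

lemma card_inversions_eq_word_inv:
  fixes g :: "int \<Rightarrow> int"
  assumes "sorted_wrt (>) ys"
  shows "int (card {(y', y). y' \<in> set ys \<and> y \<in> set ys \<and> y' < y \<and> g y' < g y}) = word_inv (map g ys)"
  using assms
proof (induction ys)
  case (Cons z zs)
  let ?I = "\<lambda>ys. {(y', y). y' \<in> set ys \<and> y \<in> set ys \<and> y' < y \<and> g y' < g y}"
  let ?N = "(\<lambda>y'. (y', z)) ` set (filter (\<lambda>y. g y < g z) zs)"
  have eq: "?I (z # zs) = ?I zs \<union> ?N" using Cons.prems by force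
  have "finite (?I zs)" by (rule finite_subset[of _ "set zs \<times> set zs"]) auto
  moreover have "?I zs \<inter> ?N = {}" using Cons.prems by auto
  ultimately have "card (?I (z # zs)) = card (?I zs) + card ?N"
    unfolding eq by (subst card_Un_disjoint) auto
  moreover have "distinct zs"
    using Cons.prems by (metis sorted_wrt.simps(2) strict_sorted_iff distinct_rev sorted_wrt_rev)
  then have "card ?N = length (filter (\<lambda>y. g y < g z) zs)"
    by (subst card_image) (auto simp: inj_on_def simp flip: distinct_card)
  ultimately show ?case using Cons by (simp add: filter_map o_def)
qed simp

lemma nonempty_row_list_eq:
  assumes "one_cells R f = (\<lambda>y. (g y, y)) ` Y"
  shows "nonempty_row_list R f = rev (sorted_list_of_set Y)"
  using assms by (simp add: nonempty_row_list_def nonempty_rows_def rows_def image_image)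

lemma sorted_rev_sorted_list_of_set: "sorted_wrt (>) (rev (sorted_list_of_set (Y :: int set)))"
  by (simp add: sorted_wrt_rev)

text \<open>In a product of contiguous sets the rectangle spanned by two cells always lies inside,
  so a chain is just an inversion of the word read from top to bottom.\<close>

lemma ne_product:
  assumes oc: "one_cells (C \<times> J) f = (\<lambda>y. (g y, y)) ` Y" and "finite Y"
    and C: "contiguous C" and J: "contiguous J"
  shows "int (ne (C \<times> J) f) = word_inv (map g (rev (sorted_list_of_set Y)))"
proof -
  let ?I = "{(y', y). y' \<in> Y \<and> y \<in> Y \<and> y' < y \<and> g y' < g y}"
  have sub: "(g y, y) \<in> C \<times> J" if "y \<in> Y" for y
    using oc that unfolding one_cells_def by blast
  have "{(a, b). ne_chain (C \<times> J) f a b} = (\<lambda>(y', y). ((g y', y'), (g y, y))) ` ?I"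
  proof (intro equalityI subsetI)
    fix p assume "p \<in> {(a, b). ne_chain (C \<times> J) f a b}"
    then show "p \<in> (\<lambda>(y', y). ((g y', y'), (g y, y))) ` ?I"
      unfolding ne_chain_def oc by (force simp: image_iff)
  next
    fix p assume "p \<in> (\<lambda>(y', y). ((g y', y'), (g y, y))) ` ?I"
    then obtain y' y where p: "p = ((g y', y'), (g y, y))"
      and *: "y' \<in> Y" "y \<in> Y" "y' < y" "g y' < g y" by auto
    have "{g y'..g y} \<times> {y'..y} \<subseteq> C \<times> J"
      using C J sub[OF *(1)] sub[OF *(2)] unfolding contiguous_def by blast
    then show "p \<in> {(a, b). ne_chain (C \<times> J) f a b}"
      using * by (simp add: p ne_chain_def oc)
  qed
  then have "ne (C \<times> J) f = card ?I"
    unfolding ne_def by (simp add: card_image inj_on_def split_beta)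
  then show ?thesis
    using card_inversions_eq_word_inv[OF sorted_rev_sorted_list_of_set, of Y g] \<open>finite Y\<close> by simp
qed

lemma des_product:
  assumes oc: "one_cells (C \<times> J) f = (\<lambda>y. (g y, y)) ` Y" and "finite Y"
    and C: "contiguous C" and J: "contiguous J"
  shows "des (C \<times> J) f = word_des (map g (rev (sorted_list_of_set Y)))"
proof -
  define ys where "ys = rev (sorted_list_of_set Y)"
  have Y: "Y = set ys" using \<open>finite Y\<close> by (simp add: ys_def)
  have sub: "(g y, y) \<in> C \<times> J" if "y \<in> Y" for y
    using oc that unfolding one_cells_def by blast
  have key: "(\<exists>a b. ne_chain (C \<times> J) f a b \<and> snd b = ys ! i \<and> snd a = ys ! Suc i) \<longleftrightarrow>
      g (ys ! Suc i) < g (ys ! i)" if i: "Suc i < length ys" for i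
  proof
    assume "\<exists>a b. ne_chain (C \<times> J) f a b \<and> snd b = ys ! i \<and> snd a = ys ! Suc i"
    then show "g (ys ! Suc i) < g (ys ! i)"
      unfolding ne_chain_def oc by auto
  next
    assume g: "g (ys ! Suc i) < g (ys ! i)"
    have *: "ys ! Suc i \<in> Y" "ys ! i \<in> Y" using i by (auto simp: Y)
    have "sorted_wrt (>) ys" unfolding ys_def by (rule sorted_rev_sorted_list_of_set)
    then have "ys ! Suc i < ys ! i" using i by (simp add: sorted_wrt_iff_nth_less)
    moreover have "{g (ys ! Suc i)..g (ys ! i)} \<times> {ys ! Suc i..ys ! i} \<subseteq> C \<times> J"
      using C J sub[OF *(1)] sub[OF *(2)] unfolding contiguous_def by blast
    ultimately have "ne_chain (C \<times> J) f (g (ys ! Suc i), ys ! Suc i) (g (ys ! i), ys ! i)"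
      using * g by (simp add: ne_chain_def oc)
    then show "\<exists>a b. ne_chain (C \<times> J) f a b \<and> snd b = ys ! i \<and> snd a = ys ! Suc i"
      by force
  qed
  have "{i. Suc i < length ys \<and>
      (\<exists>a b. ne_chain (C \<times> J) f a b \<and> snd b = ys ! i \<and> snd a = ys ! Suc i)} =
      {i. Suc i < length (map g ys) \<and> map g ys ! Suc i < map g ys ! i}"
    (is "Collect ?A = Collect ?B")
  proof (rule Collect_cong)
    show "?A i \<longleftrightarrow> ?B i" for i
      using key[of i] by (cases "Suc i < length ys") (simp_all only: length_map nth_map Suc_lessD simp_thms)
  qed
  then show ?thesis
    unfolding des_def nonempty_row_list_eq[OF oc] word_des_def ys_def[symmetric] by simp
qed

text \<open>Cutting the rectangle at row \<open>r\<close> gives again a product of contiguous sets,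
  whose word is the prefix down to \<open>r\<close>.\<close>

lemma maj_rectangle_product:
  assumes oc: "one_cells (C \<times> J) f = (\<lambda>y. (g y, y)) ` Y" and fin: "finite Y"
    and C: "contiguous C" and J: "contiguous J"
  shows "int (maj_rectangle (C \<times> J) f) = word_maj (map g (rev (sorted_list_of_set Y)))"
proof -
  have "des {c \<in> C \<times> J. r \<le> snd c} f =
      word_des (map g (filter (\<lambda>y. r \<le> y) (rev (sorted_list_of_set Y))))" for r
  proof -
    have eq: "{c \<in> C \<times> J. r \<le> snd c} = C \<times> (J \<inter> {r..})" by auto
    have "one_cells (C \<times> (J \<inter> {r..})) f = {c \<in> one_cells (C \<times> J) f. r \<le> snd c}"
      unfolding one_cells_def by auto
    also have "\<dots> = (\<lambda>y. (g y, y)) ` (Y \<inter> {r..})" unfolding oc by auto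
    finally have oc': "one_cells (C \<times> (J \<inter> {r..})) f = (\<lambda>y. (g y, y)) ` (Y \<inter> {r..})" .
    have "contiguous (J \<inter> {r..})" using J by (auto simp: contiguous_def)
    moreover have "sorted_list_of_set (Y \<inter> {r..}) = filter (\<lambda>y. r \<le> y) (sorted_list_of_set Y)"
    proof (rule strict_sorted_equal)
      show "sorted_wrt (<) (filter ((\<le>) r) (sorted_list_of_set Y))"
        by (simp add: sorted_wrt_filter)
    qed (use fin in auto)
    ultimately show ?thesis
      unfolding eq using des_product[OF oc' _ C] fin by (simp add: rev_filter)
  qed
  then show ?thesis
    unfolding maj_rectangle_def nonempty_row_list_eq[OF oc]
    by (simp add: sum_word_des_eq_word_maj[OF sorted_rev_sorted_list_of_set])
qed

section \<open>Removing an end column\<close>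

lemma contiguous_eq_interval:
  assumes "contiguous S" "finite S" "S \<noteq> {}" shows "S = {Min S..Max S}"
proof
  show "{Min S..Max S} \<subseteq> S"
    using assms Min_in Max_in unfolding contiguous_def by blast
qed (use assms in auto)

lemma rectangle_iff:
  "rectangle R \<longleftrightarrow> (\<exists>X Y. R = X \<times> Y \<and> contiguous X \<and> contiguous Y \<and>
     finite X \<and> finite Y \<and> X \<noteq> {} \<and> Y \<noteq> {})"
proof
  assume "rectangle R"
  then obtain a b c d where "a \<le> b" "c \<le> d" "R = {a..b} \<times> {c..d}" unfolding rectangle_def by blast
  then show "\<exists>X Y. R = X \<times> Y \<and> contiguous X \<and> contiguous Y \<and>
      finite X \<and> finite Y \<and> X \<noteq> {} \<and> Y \<noteq> {}"
    by (intro exI[of _ "{a..b}"] exI[of _ "{c..d}"]) (auto simp: contiguous_def)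
next
  assume "\<exists>X Y. R = X \<times> Y \<and> contiguous X \<and> contiguous Y \<and>
      finite X \<and> finite Y \<and> X \<noteq> {} \<and> Y \<noteq> {}"
  then obtain X Y where R: "R = X \<times> Y" and X: "contiguous X" "finite X" "X \<noteq> {}"
    and Y: "contiguous Y" "finite Y" "Y \<noteq> {}" by blast
  show "rectangle R" unfolding rectangle_def R
    using contiguous_eq_interval[OF X] contiguous_eq_interval[OF Y] X Y
    by (metis Max_ge Min_in)
qed

lemma moon_polyominoD:
  assumes "moon_polyomino P"
  shows "finite P" "contiguous (column_cells P x)" "contiguous (row_cells P y)"
    "column_cells P x \<subseteq> column_cells P x' \<or> column_cells P x' \<subseteq> column_cells P x"
proof -
  show "finite P" "contiguous (column_cells P x)" "contiguous (row_cells P y)"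
    using assms by (auto simp: moon_polyomino_def convex_polyomino_def polyomino_def)
  have "column_cells P x = {}" if "x \<notin> columns P" for x
    using that by (force simp: column_cells_def columns_def)
  then show "column_cells P x \<subseteq> column_cells P x' \<or> column_cells P x' \<subseteq> column_cells P x"
    using assms by (auto simp: moon_polyomino_def intersection_free_def)
qed

lemma mem_column_cells: "y \<in> column_cells P x \<longleftrightarrow> (x, y) \<in> P"
  by (simp add: column_cells_def)

lemma mem_row_cells: "x \<in> row_cells P y \<longleftrightarrow> (x, y) \<in> P"
  by (simp add: row_cells_def)

lemma mem_columns: "x \<in> columns P \<longleftrightarrow> (\<exists>y. (x, y) \<in> P)"
  by (force simp: columns_def)

lemma product_columns:
  assumes "X \<times> Y \<subseteq> P" "Y \<noteq> {}" shows "X \<subseteq> columns P"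
  using assms by (auto simp: mem_columns)

locale end_column =
  fixes P :: "cell set" and x :: int
  assumes moon: "moon_polyomino P"
    and x_in: "x \<in> columns P"
    and shortest: "x' \<in> columns P \<Longrightarrow> column_cells P x \<subseteq> column_cells P x'"
    and extremal: "extremal x (columns P - {x})"
begin

abbreviation "J \<equiv> column_cells P x"
abbreviation "C \<equiv> columns P"
abbreviation "C' \<equiv> columns P - {x}"
definition "P' = {c \<in> P. fst c \<noteq> x}"

end

text \<open>By row convexity, the rows common to the leftmost and the rightmost column meet every
  column. The two end columns are comparable, so the smaller one equals this intersection.\<close>

lemma ex_end_column:
  assumes moon: "moon_polyomino P" and "P \<noteq> {}"
  shows "\<exists>x. end_column P x"
proof -
  have fin: "finite (columns P)" using moon_polyominoD(1)[OF moon] by (simp add: columns_def)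
  have ne: "columns P \<noteq> {}" using assms by (simp add: columns_def)
  let ?a = "Min (columns P)" and ?b = "Max (columns P)"
  have between: "column_cells P ?a \<inter> column_cells P ?b \<subseteq> column_cells P x'"
    if "x' \<in> columns P" for x'
  proof
    fix y assume "y \<in> column_cells P ?a \<inter> column_cells P ?b"
    then have "{?a..?b} \<subseteq> row_cells P y"
      using moon_polyominoD(3)[OF moon, of y] unfolding contiguous_def
      by (simp add: mem_column_cells mem_row_cells)
    moreover have "x' \<in> {?a..?b}" using fin that by simp
    ultimately show "y \<in> column_cells P x'" by (auto simp: mem_column_cells mem_row_cells)
  qed
  consider "column_cells P ?a \<subseteq> column_cells P ?b" | "column_cells P ?b \<subseteq> column_cells P ?a"
    using moon_polyominoD(4)[OF moon] by blast
  then show ?thesis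
  proof cases
    case 1
    have "end_column P ?a"
    proof
      show "extremal ?a (columns P - {?a})"
        using fin unfolding extremal_def by (auto simp: order.strict_iff_order)
    qed (use moon fin ne between 1 in auto)
    then show ?thesis ..
  next
    case 2
    have "end_column P ?b"
    proof
      show "extremal ?b (columns P - {?b})"
        using fin unfolding extremal_def by (auto simp: order.strict_iff_order)
    qed (use moon fin ne between 2 in auto)
    then show ?thesis ..
  qed
qed

text \<open>A row through the shortest column meets every column, so the set of columns is the cell
  set of that one row.\<close>

lemma contiguous_columns:
  assumes moon: "moon_polyomino P" shows "contiguous (columns P)"
proof (cases "P = {}")
  case False
  then obtain x where "end_column P x" using ex_end_column moon by blast
  then interpret end_column P x .
  obtain y where "y \<in> J" using x_in by (auto simp: mem_columns mem_column_cells)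
  then have "y \<in> column_cells P x'" if "x' \<in> columns P" for x'
    using shortest[OF that] by blast
  then have "columns P = row_cells P y"
    by (auto simp: mem_row_cells mem_column_cells) (auto simp: mem_columns)
  then show ?thesis using moon_polyominoD(3)[OF moon] by metis
qed (simp add: contiguous_def columns_def)

lemma contiguous_INT:
  assumes "\<And>i. i \<in> I \<Longrightarrow> contiguous (S i)" shows "contiguous (\<Inter>i\<in>I. S i)"
  unfolding contiguous_def
proof (intro ballI INT_greatest)
  fix a b i assume "a \<in> (\<Inter>i\<in>I. S i)" "b \<in> (\<Inter>i\<in>I. S i)" "i \<in> I"
  then show "{a..b} \<subseteq> S i" using assms[of i] unfolding contiguous_def by simp
qed

lemma contiguous_remove_extremal:
  assumes "contiguous S" "extremal x (S - {x})" shows "contiguous (S - {x})"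
  unfolding contiguous_def
proof (intro ballI subsetI)
  fix a b z assume ab: "a \<in> S - {x}" "b \<in> S - {x}" and z: "z \<in> {a..b}"
  then have "z \<in> S" using assms(1) unfolding contiguous_def by blast
  moreover have "a < x \<and> b < x \<or> x < a \<and> x < b" using assms(2) ab unfolding extremal_def by blast
  then have "z \<noteq> x" using z by auto
  ultimately show "z \<in> S - {x}" by blast
qed

text \<open>A maximal rectangle contains all rows common to its columns, since otherwise it could be
  enlarged vertically to \<open>X \<times> Z\<close>.\<close>

lemma subset_rows_maximal_rectangle:
  assumes moon: "moon_polyomino P" and R: "R \<in> maximal_rectangles P"
    and K: "\<And>x'. x' \<in> columns P \<Longrightarrow> K \<subseteq> column_cells P x'"
  shows "K \<subseteq> rows R"
proof -
  from R obtain X Y where R_eq: "R = X \<times> Y" and XY: "contiguous X" "contiguous Y"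
      "finite X" "finite Y" "X \<noteq> {}" "Y \<noteq> {}" and RP: "R \<subseteq> P"
    unfolding maximal_rectangles_def rectangle_iff by blast
  define Z where "Z = (\<Inter>x'\<in>X. column_cells P x')"
  have XC: "X \<subseteq> columns P" using RP R_eq XY by (auto simp: mem_columns)
  have "Y \<subseteq> Z" using RP R_eq unfolding Z_def by (auto simp: mem_column_cells)
  have "contiguous Z" unfolding Z_def using moon_polyominoD(2)[OF moon] by (intro contiguous_INT)
  moreover have "finite Z"
  proof -
    obtain x' where "x' \<in> X" using XY by blast
    then have "Z \<subseteq> snd ` P" unfolding Z_def by (force simp: mem_column_cells)
    then show ?thesis using moon_polyominoD(1)[OF moon] finite_subset by blast
  qed
  ultimately have "rectangle (X \<times> Z)" using XY \<open>Y \<subseteq> Z\<close> unfolding rectangle_iff by blast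
  moreover have "X \<times> Z \<subseteq> P" unfolding Z_def by (auto simp: mem_column_cells)
  ultimately have "X \<times> Z = X \<times> Y"
    using R \<open>Y \<subseteq> Z\<close> unfolding maximal_rectangles_def R_eq by blast
  then have "Z = Y" using XY by blast
  then show ?thesis using K XC XY unfolding R_eq rows_def Z_def by (auto simp: snd_image_times)
qed

lemma finite_maximal_rectangles: "finite P \<Longrightarrow> finite (maximal_rectangles P)"
  by (rule finite_subset[of _ "Pow P"]) (auto simp: maximal_rectangles_def)

context end_column
begin

lemma finite_P: "finite P" and finite_J: "finite J" and finite_C: "finite C"
proof -
  show "finite P" using moon by (rule moon_polyominoD)
  then show "finite C" by (simp add: columns_def)
  have "J \<subseteq> snd ` P" by (force simp: mem_column_cells)
  then show "finite J" using \<open>finite P\<close> finite_subset by blast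
qed

lemma J_nonempty: "J \<noteq> {}"
  using x_in by (auto simp: mem_columns mem_column_cells)

lemma contiguous_J: "contiguous J" and contiguous_C: "contiguous C"
  and contiguous_C': "contiguous C'"
  using moon_polyominoD(2)[OF moon] contiguous_columns[OF moon]
    contiguous_remove_extremal[OF _ extremal] by blast+

lemma column_cells_P': "x' \<noteq> x \<Longrightarrow> column_cells P' x' = column_cells P x'"
  by (simp add: column_cells_def P'_def)

lemma columns_P': "columns P' = C'"
  by (auto simp: mem_columns P'_def)

lemma P'_subset: "P' \<subseteq> P"
  by (auto simp: P'_def)

lemma moon_P': "moon_polyomino P'"
proof -
  have "contiguous (column_cells P' x')" for x'
  proof (cases "x' = x")
    case True
    then have "column_cells P' x' = {}" by (simp add: column_cells_def P'_def)
    then show ?thesis by (simp add: contiguous_def)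
  next
    case False
    then show ?thesis using column_cells_P' moon_polyominoD(2)[OF moon] by simp
  qed
  moreover have "contiguous (row_cells P' y)" for y
  proof -
    have "row_cells P' y = row_cells P y - {x}" by (auto simp: row_cells_def P'_def)
    moreover have "row_cells P y - {x} \<subseteq> C'" by (auto simp: mem_columns mem_row_cells)
    ultimately show ?thesis
      using contiguous_remove_extremal moon_polyominoD(3)[OF moon] extremal extremal_subset by metis
  qed
  moreover have "intersection_free P'"
    using columns_P' column_cells_P' moon_polyominoD(4)[OF moon] by (auto simp: intersection_free_def)
  moreover have "finite P'" using finite_P P'_subset finite_subset by blast
  ultimately show ?thesis by (simp add: moon_polyomino_def convex_polyomino_def polyomino_def)
qed

lemma C_J_subset: "C \<times> J \<subseteq> P"
proof clarify
  fix x' y assume "x' \<in> C" "y \<in> J"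
  then have "y \<in> column_cells P x'" using shortest by blast
  then show "(x', y) \<in> P" by (simp only: mem_column_cells)
qed

lemma C'_J_subset: "C' \<times> J \<subseteq> P'"
  using C_J_subset by (auto simp: P'_def)

lemma product_column_x:
  assumes "X \<times> Y \<subseteq> P" "x \<in> X" shows "Y \<subseteq> J"
  using assms by (auto simp: mem_column_cells)

lemma C_J_maximal: "C \<times> J \<in> maximal_rectangles P"
proof -
  have "rectangle (C \<times> J)"
    unfolding rectangle_iff using contiguous_C contiguous_J finite_C finite_J J_nonempty x_in by blast
  moreover have "R' = C \<times> J" if sup: "rectangle R'" "R' \<subseteq> P" "C \<times> J \<subseteq> R'" for R'
  proof -
    obtain X Y where R': "R' = X \<times> Y" "X \<noteq> {}" "Y \<noteq> {}"
      using sup(1) unfolding rectangle_iff by blast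
    then have "x \<in> X" using that(3) x_in J_nonempty by auto
    then have "Y \<subseteq> J" "X \<subseteq> C" using product_column_x product_columns that(2) R' by auto
    then show ?thesis using that(3) R' by auto
  qed
  ultimately show ?thesis using C_J_subset unfolding maximal_rectangles_def by blast
qed

text \<open>Every maximal rectangle contains the rows \<open>J\<close>, and one with no further rows
  would lie in \<open>C \<times> J\<close>. Being strictly the shortest, \<open>C \<times> J\<close>
  heads \<open>rectangle_list P\<close>.\<close>

lemma card_J_less_height:
  assumes R: "R \<in> maximal_rectangles P" "R \<noteq> C \<times> J"
  shows "height (C \<times> J) < height R"
proof -
  from R obtain X Y where R_eq: "R = X \<times> Y" and XY: "X \<noteq> {}" "Y \<noteq> {}" "finite Y"
    and RP: "R \<subseteq> P"
    unfolding maximal_rectangles_def rectangle_iff by blast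
  have "rows R = Y" using XY by (simp add: R_eq rows_def snd_image_times)
  have "J \<subseteq> Y"
    using subset_rows_maximal_rectangle[OF moon R(1) shortest] \<open>rows R = Y\<close> by simp
  moreover have "Y \<noteq> J"
  proof
    assume "Y = J"
    then have "R \<subseteq> C \<times> J" using product_columns[of X Y] RP XY R_eq by auto
    then show False using R C_J_maximal unfolding maximal_rectangles_def by blast
  qed
  moreover have "rows (C \<times> J) = J" using x_in by (auto simp: rows_def snd_image_times)
  ultimately show ?thesis using \<open>rows R = Y\<close> \<open>finite Y\<close>
    unfolding height_def by (auto intro!: psubset_card_mono)
qed

text \<open>A rectangle through column \<open>x\<close> has its rows in \<open>J\<close> and so lies
  in \<open>C \<times> J\<close>; all other maximal rectangles avoid \<open>x\<close>. The set
  difference on the right covers both possibilities for \<open>C' \<times> J\<close>, which may or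
  may not be maximal in \<open>P'\<close>.\<close>

lemma maximal_rectangles_P':
  "maximal_rectangles P - {C \<times> J} = maximal_rectangles P' - {C' \<times> J}"
proof (intro equalityI subsetI)
  fix R assume "R \<in> maximal_rectangles P - {C \<times> J}"
  then have R: "rectangle R" "R \<subseteq> P" "R \<noteq> C \<times> J"
    "\<And>R'. rectangle R' \<Longrightarrow> R' \<subseteq> P \<Longrightarrow> R \<subseteq> R' \<Longrightarrow> R' = R"
    by (auto simp: maximal_rectangles_def)
  have CJ: "rectangle (C \<times> J)" "C \<times> J \<subseteq> P"
    using C_J_maximal by (auto simp: maximal_rectangles_def)
  obtain X Y where R_eq: "R = X \<times> Y" "Y \<noteq> {}" using R(1) unfolding rectangle_iff by blast
  have "x \<notin> X"
  proof
    assume "x \<in> X"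
    then have "Y \<subseteq> J" "X \<subseteq> C"
      using product_column_x[of X Y] product_columns[of X Y P] R(2) R_eq by auto
    then have "R \<subseteq> C \<times> J" unfolding R_eq by (intro Sigma_mono)
    then show False using R(3,4) CJ by blast
  qed
  then have "R \<subseteq> P'" using R(2) by (auto simp: P'_def R_eq)
  moreover have "R \<noteq> C' \<times> J"
  proof
    assume "R = C' \<times> J"
    then have "C \<times> J = R" using R(4) CJ by blast
    then show False using R(3) by blast
  qed
  moreover have "R' = R" if "rectangle R'" "R' \<subseteq> P'" "R \<subseteq> R'" for R'
    using R(4) that P'_subset by (meson order_trans)
  ultimately show "R \<in> maximal_rectangles P' - {C' \<times> J}"
    using R(1) by (auto simp: maximal_rectangles_def)
next
  fix R assume "R \<in> maximal_rectangles P' - {C' \<times> J}"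
  then have R: "rectangle R" "R \<subseteq> P'" "R \<noteq> C' \<times> J"
    "\<And>R'. rectangle R' \<Longrightarrow> R' \<subseteq> P' \<Longrightarrow> R \<subseteq> R' \<Longrightarrow> R' = R"
    by (auto simp: maximal_rectangles_def)
  obtain X Y where R_eq: "R = X \<times> Y" "X \<noteq> {}" "Y \<noteq> {}" using R(1) unfolding rectangle_iff by blast
  have "x \<notin> X" using R(2) R_eq by (auto simp: P'_def)
  have "R' = R" if R': "rectangle R'" "R' \<subseteq> P" "R \<subseteq> R'" for R'
  proof -
    obtain X' Y' where R'_eq: "R' = X' \<times> Y'" using R'(1) unfolding rectangle_iff by blast
    have sub: "X \<subseteq> X'" "Y \<subseteq> Y'" using R' R_eq R'_eq by auto
    have "x \<notin> X'"
    proof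
      assume "x \<in> X'"
      then have "Y \<subseteq> J" using product_column_x R'(2) R'_eq sub by blast
      moreover have "X \<subseteq> C'" using product_columns[of X Y P'] R(2) R_eq columns_P' by simp
      ultimately have "R \<subseteq> C' \<times> J" using R_eq by auto
      moreover have "rectangle (C' \<times> J)"
        unfolding rectangle_iff
        using contiguous_C' contiguous_J finite_C finite_J J_nonempty \<open>X \<subseteq> C'\<close> R_eq(2) by blast
      ultimately show False using R(3,4) C'_J_subset by blast
    qed
    then have "R' \<subseteq> P'" using R'(2) by (auto simp: P'_def R'_eq)
    then show ?thesis using R(4) R' by blast
  qed
  moreover have "R \<noteq> C \<times> J" using \<open>x \<notin> X\<close> R_eq x_in J_nonempty by auto
  moreover have "R \<subseteq> P" using R(2) P'_subset by (rule order_trans)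
  ultimately show "R \<in> maximal_rectangles P - {C \<times> J}"
    using R(1) by (auto simp: maximal_rectangles_def)
qed

lemma maximal_rectangles_eq:
  "maximal_rectangles P = insert (C \<times> J) (maximal_rectangles P' - {C' \<times> J})"
  unfolding maximal_rectangles_P'[symmetric] using insert_Diff[OF C_J_maximal] by (rule sym)

lemma card_P'_less: "card P' < card P"
proof -
  obtain y where "(x, y) \<in> P" using x_in by (auto simp: mem_columns)
  moreover have "(x, y) \<notin> P'" by (simp add: P'_def)
  ultimately have "P' \<subset> P" using P'_subset by blast
  then show ?thesis using finite_P psubset_card_mono by blast
qed

end

text \<open>Columns are put back one at a time, and the only rectangle that this can add is strictly
  the shortest. Injectivity of the key guarantees that \<open>sorted_key_list_of_set\<close> lists
  the whole set.\<close>

lemma inj_on_height: "moon_polyomino P \<Longrightarrow> inj_on height (maximal_rectangles P)"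
proof (induction "card P" arbitrary: P rule: less_induct)
  case less
  show ?case
  proof (cases "P = {}")
    case True
    then have "maximal_rectangles P = {}" by (auto simp: maximal_rectangles_def rectangle_iff)
    then show ?thesis by simp
  next
    case False
    then obtain x where "end_column P x" using ex_end_column less.prems by blast
    then interpret end_column P x .
    have "inj_on height (maximal_rectangles P')" using less.hyps card_P'_less moon_P' by blast
    then have "inj_on height (maximal_rectangles P' - {C' \<times> J})" by (rule inj_on_subset) auto
    moreover have "height (C \<times> J) < height R" if "R \<in> maximal_rectangles P' - {C' \<times> J}" for R
      using that card_J_less_height maximal_rectangles_P' by auto
    ultimately show ?thesis
      unfolding maximal_rectangles_eq inj_on_insert by force
  qed
qed

section \<open>Lists sorted by an injective key\<close>

context linorder begin

lemma sorted_key_list_of_set_insert_min: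
  fixes f :: "'b \<Rightarrow> 'a"
  assumes "inj_on f (insert a M)" "finite M" "\<And>b. b \<in> M \<Longrightarrow> f a < f b"
  shows "sorted_key_list_of_set f (insert a M) = a # sorted_key_list_of_set f M"
proof -
  interpret K: folding_insort_key "(\<le>)" "(<)" "insert a M" f
    using assms(1) by unfold_locales
  have "a \<notin> M" using assms(3) by blast
  have "set (sorted_key_list_of_set f M) = M" using assms(2) by (intro K.set_sorted_key_list_of_set) auto
  then have "insort_key f a (sorted_key_list_of_set f M) = a # sorted_key_list_of_set f M"
    using assms(3) by (intro insort_is_Cons) (auto intro: less_imp_le)
  then show ?thesis
    using K.sorted_key_list_of_set_insert[of a M] assms(2) \<open>a \<notin> M\<close> by simp
qed

lemma set_sorted_key_list_of_set_inj_on: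
  fixes f :: "'b \<Rightarrow> 'a"
  assumes "inj_on f M" "finite M" shows "set (sorted_key_list_of_set f M) = M"
proof -
  interpret K: folding_insort_key "(\<le>)" "(<)" M f
    using assms(1) by unfold_locales
  show ?thesis using assms(2) by (intro K.set_sorted_key_list_of_set) auto
qed

lemma sorted_key_list_of_set_empty': "sorted_key_list_of_set f {} = []"
proof -
  interpret K: folding_insort_key "(\<le>)" "(<)" "{}" f by unfold_locales simp
  show ?thesis by (rule K.sorted_key_list_of_set_empty)
qed

end


context end_column
begin

lemma rectangle_list_eq:
  "rectangle_list P = (C \<times> J) # sorted_key_list_of_set height (maximal_rectangles P' - {C' \<times> J})"
proof -
  have "inj_on height (insert (C \<times> J) (maximal_rectangles P' - {C' \<times> J}))"
    using inj_on_height[OF moon] maximal_rectangles_eq by simp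
  moreover have "finite (maximal_rectangles P' - {C' \<times> J})"
    using finite_maximal_rectangles moon_polyominoD(1)[OF moon_P'] by blast
  moreover have "height (C \<times> J) < height R" if "R \<in> maximal_rectangles P' - {C' \<times> J}" for R
    using that card_J_less_height maximal_rectangles_P' by auto
  ultimately show ?thesis
    unfolding rectangle_list_def maximal_rectangles_eq by (rule sorted_key_list_of_set_insert_min)
qed

end

section \<open>Both statistics under the removal of a column\<close>

definition list_maj :: "cell set list \<Rightarrow> (cell \<Rightarrow> nat) \<Rightarrow> int" where
  "list_maj Rs f = (\<Sum>i<length Rs. int (maj_rectangle (Rs ! i) f))
     - (\<Sum>i<length Rs - 1. int (maj_rectangle (Rs ! i \<inter> Rs ! Suc i) f))"

lemma list_maj_Nil: "list_maj [] f = 0"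
  by (simp add: list_maj_def)

lemma list_maj_single: "list_maj [R] f = int (maj_rectangle R f)"
  by (simp add: list_maj_def)

lemma list_maj_Cons_Cons:
  "list_maj (R # R' # Rs) f =
     int (maj_rectangle R f) - int (maj_rectangle (R \<inter> R') f) + list_maj (R' # Rs) f"
  by (simp add: list_maj_def sum.lessThan_Suc_shift del: sum.lessThan_Suc)

lemma maj_eq_list_maj: "maj P f = list_maj (rectangle_list P) f"
  by (simp add: maj_def list_maj_def Let_def)

lemma maj_rectangle_empty: "maj_rectangle {} f = 0"
  by (simp add: maj_rectangle_def nonempty_row_list_def nonempty_rows_def rows_def one_cells_def)

lemma ne_chain_iff:
  "ne_chain P f (a1, a2) (b1, b2) \<longleftrightarrow> f (a1, a2) = 1 \<and> f (b1, b2) = 1 \<and> a1 < b1 \<and> a2 < b2 \<and>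
     {a1..b1} \<times> {a2..b2} \<subseteq> P"
proof -
  have "(a1, a2) \<in> {a1..b1} \<times> {a2..b2}" "(b1, b2) \<in> {a1..b1} \<times> {a2..b2}"
    if "a1 < b1" "a2 < b2" using that by auto
  then show ?thesis unfolding ne_chain_def one_cells_def by auto
qed

context end_column
begin

text \<open>Let \<open>K\<close> be the rows of the shortest column of \<open>P'\<close>, so that
  \<open>C' \<times> K\<close> heads its rectangle list. If \<open>K = J\<close>, this head is
  replaced by \<open>C \<times> J\<close>, and the overlap with the next rectangle stays the same
  because that rectangle avoids column \<open>x\<close>. Otherwise \<open>C \<times> J\<close> is a
  new head, and its overlap with \<open>C' \<times> K\<close> is
  \<open>C' \<times> J\<close>.\<close>

lemma maj_remove_column:
  "maj P f = maj P' f + int (maj_rectangle (C \<times> J) f) - int (maj_rectangle (C' \<times> J) f)"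
proof (cases "P' = {}")
  case True
  then have "maximal_rectangles P' = {}" by (auto simp: maximal_rectangles_def rectangle_iff)
  moreover have "C' = {}" using columns_P' True by (auto simp: columns_def)
  then have "C' \<times> J = {}" by (simp only: Sigma_empty1)
  moreover have "sorted_key_list_of_set height {} = []"
    by (rule sorted_key_list_of_set_empty')
  ultimately show ?thesis
    using rectangle_list_eq maj_rectangle_empty
    by (simp only: maj_rectangle_empty) (simp add: maj_eq_list_maj rectangle_list_def list_maj_Nil list_maj_single)
next
  case False
  then obtain x' where "end_column P' x'" using ex_end_column moon_P' by blast
  then interpret Q: end_column P' x' .
  let ?K = "column_cells P' x'"
  have K: "J \<subseteq> ?K"
    using Q.x_in columns_P' column_cells_P' shortest by auto
  define Rs where "Rs = sorted_key_list_of_set height (maximal_rectangles Q.P' - {Q.C' \<times> ?K})"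
  have list': "rectangle_list P' = (C' \<times> ?K) # Rs"
    using Q.rectangle_list_eq columns_P' unfolding Rs_def by simp
  show ?thesis
  proof (cases "?K = J")
    case True
    have list: "rectangle_list P = (C \<times> J) # Rs"
      unfolding rectangle_list_eq Rs_def
      using Q.maximal_rectangles_P' columns_P' True by simp
    have sub: "R \<subseteq> P'" if "R \<in> set Rs" for R
    proof -
      have subset: "maximal_rectangles Q.P' - {Q.C' \<times> ?K} \<subseteq> maximal_rectangles P'"
        unfolding Q.maximal_rectangles_P'[symmetric] by (rule Diff_subset)
      then have "set Rs = maximal_rectangles Q.P' - {Q.C' \<times> ?K}" unfolding Rs_def
        using inj_on_height[OF moon_P'] finite_maximal_rectangles[OF Q.finite_P]
        by (intro set_sorted_key_list_of_set_inj_on) (metis inj_on_subset, metis finite_subset)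
      then have "set Rs \<subseteq> maximal_rectangles P'" using subset by (simp only:)
      then show ?thesis using that by (auto simp: maximal_rectangles_def)
    qed
    show ?thesis
    proof (cases Rs)
      case Nil
      then show ?thesis using list list' True by (simp add: maj_eq_list_maj list_maj_single)
    next
      case (Cons R Rs')
      have "R \<subseteq> P'" using sub Cons by simp
      then have "C \<times> J \<inter> R = C' \<times> J \<inter> R" by (auto simp: P'_def)
      then show ?thesis using list list' True Cons by (simp add: maj_eq_list_maj list_maj_Cons_Cons)
    qed
  next
    case neq: False
    have "C' \<times> J \<notin> maximal_rectangles P'"
    proof
      assume "C' \<times> J \<in> maximal_rectangles P'"
      moreover have "C' \<times> J \<subseteq> C' \<times> ?K" using K by auto
      moreover have "C' \<times> ?K \<in> maximal_rectangles P'" using Q.C_J_maximal columns_P' by simp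
      ultimately have "C' \<times> ?K = C' \<times> J" unfolding maximal_rectangles_def by blast
      then show False using neq Q.x_in columns_P' by auto
    qed
    then have "rectangle_list P = (C \<times> J) # rectangle_list P'"
      unfolding rectangle_list_eq by (simp add: rectangle_list_def)
    moreover have "C \<times> J \<inter> C' \<times> ?K = C' \<times> J" using K by auto
    ultimately show ?thesis
      using list' by (simp add: maj_eq_list_maj list_maj_Cons_Cons)
  qed
qed

text \<open>A chain of \<open>P\<close> that is lost in \<open>P'\<close> spans a rectangle meeting
  column \<open>x\<close>. Such a rectangle has its rows in \<open>J\<close>, so the lost chains are
  those that \<open>C \<times> J\<close> has beyond \<open>C' \<times> J\<close>.\<close>

lemma ne_remove_column:
  "int (ne P f) = int (ne P' f) + int (ne (C \<times> J) f) - int (ne (C' \<times> J) f)"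
proof -
  let ?N = "\<lambda>R. {(a, b). ne_chain R f a b}"
  have fin: "finite (?N R)" if "finite R" for R
    by (rule finite_subset[of _ "R \<times> R"]) (use that in \<open>auto simp: ne_chain_def one_cells_def\<close>)
  have mono: "?N R \<subseteq> ?N R'" if "R \<subseteq> R'" for R R'
    using that unfolding ne_chain_def one_cells_def by blast
  have "?N P - ?N P' = ?N (C \<times> J) - ?N (C' \<times> J)"
  proof (intro equalityI subsetI)
    fix p assume p: "p \<in> ?N P - ?N P'"
    then obtain a b where ab: "p = (a, b)" "ne_chain P f a b" "\<not> ne_chain P' f a b" by auto
    obtain a1 a2 b1 b2 where eq: "a = (a1, a2)" "b = (b1, b2)" by fastforce
    have ch: "f a = 1" "f b = 1" "a1 < b1" "a2 < b2" and sub: "{a1..b1} \<times> {a2..b2} \<subseteq> P"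
      using ab(2) by (simp_all add: ne_chain_iff eq)
    have "x \<in> {a1..b1}"
    proof (rule ccontr)
      assume "x \<notin> {a1..b1}"
      then have "{a1..b1} \<times> {a2..b2} \<subseteq> P'" using sub by (auto simp: P'_def)
      then show False using ab(3) ch by (simp add: ne_chain_iff eq)
    qed
    then have "{a2..b2} \<subseteq> J" using product_column_x[OF sub] by blast
    moreover have "{a1..b1} \<subseteq> C" using product_columns[OF sub] ch by auto
    ultimately have "{a1..b1} \<times> {a2..b2} \<subseteq> C \<times> J" by (intro Sigma_mono)
    then have "ne_chain (C \<times> J) f a b"
      using ch by (simp add: ne_chain_iff eq)
    moreover have "(x, a2) \<in> {a1..b1} \<times> {a2..b2}" using \<open>x \<in> {a1..b1}\<close> ch by simp
    then have "\<not> ne_chain (C' \<times> J) f a b" unfolding ne_chain_iff eq by blast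
    ultimately show "p \<in> ?N (C \<times> J) - ?N (C' \<times> J)" using ab by simp
  next
    fix p assume p: "p \<in> ?N (C \<times> J) - ?N (C' \<times> J)"
    then obtain a b where ab: "p = (a, b)" "ne_chain (C \<times> J) f a b" "\<not> ne_chain (C' \<times> J) f a b"
      by auto
    obtain a1 a2 b1 b2 where eq: "a = (a1, a2)" "b = (b1, b2)" by fastforce
    have ch: "f a = 1" "f b = 1" "a1 < b1" "a2 < b2" and sub: "{a1..b1} \<times> {a2..b2} \<subseteq> C \<times> J"
      using ab(2) by (simp_all add: ne_chain_iff eq)
    have "x \<in> {a1..b1}"
    proof (rule ccontr)
      assume "x \<notin> {a1..b1}"
      then have "{a1..b1} \<times> {a2..b2} \<subseteq> C' \<times> J" using sub by auto
      then show False using ab(3) ch by (simp add: ne_chain_iff eq)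
    qed
    then have "(x, a2) \<in> {a1..b1} \<times> {a2..b2}" using ch by simp
    moreover have "(x, a2) \<notin> P'" by (simp add: P'_def)
    ultimately have "\<not> ne_chain P' f a b" unfolding ne_chain_iff eq by blast
    then show "p \<in> ?N P - ?N P'" using ab p mono[OF C_J_subset] by blast
  qed
  moreover have "card (?N P - ?N P') = card (?N P) - card (?N P')" "card (?N P') \<le> card (?N P)"
    using mono[OF P'_subset] fin[OF finite_P] fin[OF moon_polyominoD(1)[OF moon_P']]
    by (auto intro: card_Diff_subset card_mono)
  moreover have "C' \<times> J \<subseteq> C \<times> J" by auto
  then have "card (?N (C \<times> J) - ?N (C' \<times> J)) = card (?N (C \<times> J)) - card (?N (C' \<times> J))"
    "card (?N (C' \<times> J)) \<le> card (?N (C \<times> J))"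
    using mono[of "C' \<times> J" "C \<times> J"] fin[of "C \<times> J"] fin[of "C' \<times> J"] finite_C finite_J
    by (auto intro: card_Diff_subset card_mono)
  ultimately have "ne P f - ne P' f = ne (C \<times> J) f - ne (C' \<times> J) f"
    "ne P' f \<le> ne P f" "ne (C' \<times> J) f \<le> ne (C \<times> J) f"
    unfolding ne_def by (simp_all only:)
  then show ?thesis by linarith
qed

end

section \<open>Fillings as words\<close>

lemma filter_rev_sorted_list_of_set:
  assumes "finite (Y :: int set)"
  shows "filter Q (rev (sorted_list_of_set Y)) = rev (sorted_list_of_set {y \<in> Y. Q y})"
proof -
  have "sorted_list_of_set {y \<in> Y. Q y} = filter Q (sorted_list_of_set Y)"
    by (rule strict_sorted_equal) (use assms in \<open>auto simp: sorted_wrt_filter\<close>)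
  then show ?thesis by (simp add: rev_filter)
qed

lemma block_map:
  "block x D (map B ys) (map g ys) = map g (filter (\<lambda>y. x \<in> B y \<and> g y \<in> D) ys)"
  by (induction ys) (auto simp: block_def)

lemma Collect_image_conj: "{c \<in> F ` Y. Q c} = F ` {y \<in> Y. Q (F y)}"
  by auto

lemma one_cells_product:
  assumes "one_cells P f = (\<lambda>y. (g y, y)) ` Y" "D \<times> K \<subseteq> P"
  shows "one_cells (D \<times> K) f = (\<lambda>y. (g y, y)) ` {y \<in> Y. y \<in> K \<and> g y \<in> D}"
proof -
  have "one_cells (D \<times> K) f = one_cells P f \<inter> D \<times> K"
    using assms(2) by (auto simp: one_cells_def)
  then show ?thesis unfolding assms(1) by auto
qed

context end_column
begin

text \<open>\<open>x \<in> row_cells P y\<close> says \<open>y \<in> J\<close>, so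
  \<open>block x D\<close> selects precisely the 1-cells in \<open>D \<times> J\<close>.\<close>

lemma product_eq_block:
  assumes oc: "one_cells P f = (\<lambda>y. (g y, y)) ` Y" and fin: "finite Y"
    and D: "contiguous D" "D \<times> J \<subseteq> P"
  defines "ys \<equiv> rev (sorted_list_of_set Y)"
  shows "int (maj_rectangle (D \<times> J) f) = word_maj (block x D (map (row_cells P) ys) (map g ys))"
    and "int (ne (D \<times> J) f) = word_inv (block x D (map (row_cells P) ys) (map g ys))"
proof -
  let ?Z = "{y \<in> Y. y \<in> J \<and> g y \<in> D}"
  have "block x D (map (row_cells P) ys) (map g ys) = map g (rev (sorted_list_of_set ?Z))"
    unfolding block_map ys_def filter_rev_sorted_list_of_set[OF fin]
    by (simp add: mem_row_cells mem_column_cells)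
  then show "int (maj_rectangle (D \<times> J) f) = word_maj (block x D (map (row_cells P) ys) (map g ys))"
    and "int (ne (D \<times> J) f) = word_inv (block x D (map (row_cells P) ys) (map g ys))"
    using maj_rectangle_product[OF one_cells_product[OF oc D(2)] _ D(1) contiguous_J]
      ne_product[OF one_cells_product[OF oc D(2)] _ D(1) contiguous_J] fin
    by simp_all
qed

end

text \<open>The quantification over \<open>g\<close> and \<open>Y\<close> is needed for the
  induction: passing to \<open>P'\<close> shrinks \<open>Y\<close> to the rows whose 1-cell lies
  outside column \<open>x\<close>.\<close>

lemma ex_removal_order:
  "moon_polyomino P \<Longrightarrow> \<exists>xs. set xs = columns P \<and> removal_order xs \<and>
     (\<forall>y. upper_part xs (row_cells P y)) \<and>
     (\<forall>f g Y. finite Y \<longrightarrow> one_cells P f = (\<lambda>y. (g y, y)) ` Y \<longrightarrow>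
       (let ys = rev (sorted_list_of_set Y); Bs = map (row_cells P) ys; w = map g ys in
         maj P f = word_stat word_maj xs Bs w \<and> int (ne P f) = word_stat word_inv xs Bs w))"
proof (induction "card P" arbitrary: P rule: less_induct)
  case less
  show ?case
  proof (cases "P = {}")
    case True
    have "maximal_rectangles P = {}"
      using True by (auto simp: maximal_rectangles_def rectangle_iff)
    then have "maj P f = 0" for f
      by (simp add: maj_eq_list_maj rectangle_list_def sorted_key_list_of_set_empty' list_maj_Nil)
    moreover have "ne P f = 0" for f
      using True by (simp add: ne_def ne_chain_def one_cells_def)
    ultimately show ?thesis
      using True by (intro exI[of _ "[]"]) (simp add: columns_def row_cells_def Let_def)
  next
    case False
    then obtain x where "end_column P x" using ex_end_column less.prems by blast
    then interpret end_column P x .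
    from less.hyps[OF card_P'_less moon_P'] obtain xs where
      xs: "set xs = C'" "removal_order xs" and up: "\<And>y. upper_part xs (row_cells P' y)"
      and stat: "\<And>f g Y. finite Y \<Longrightarrow> one_cells P' f = (\<lambda>y. (g y, y)) ` Y \<Longrightarrow>
       (let ys = rev (sorted_list_of_set Y); Bs = map (row_cells P') ys; w = map g ys in
         maj P' f = word_stat word_maj xs Bs w \<and> int (ne P' f) = word_stat word_inv xs Bs w)"
      unfolding columns_P' by blast
    have set_xs: "set (x # xs) = C" using xs(1) x_in by auto
    have "extremal x (set xs)" using extremal xs(1) by simp
    moreover have "upper_part (x # xs) (row_cells P y)" for y
    proof -
      have "row_cells P y = C" if "x \<in> row_cells P y"
      proof -
        have "y \<in> J" using that by (simp add: mem_row_cells mem_column_cells)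
        then have "C \<subseteq> row_cells P y" using C_J_subset by (auto simp: mem_row_cells)
        then show ?thesis by (auto simp: mem_row_cells mem_columns)
      qed
      moreover have "row_cells P y - {x} = row_cells P' y" by (auto simp: row_cells_def P'_def)
      ultimately show ?thesis using up set_xs by simp
    qed
    moreover have "maj P f = word_stat word_maj (x # xs) (map (row_cells P) ys) (map g ys) \<and>
        int (ne P f) = word_stat word_inv (x # xs) (map (row_cells P) ys) (map g ys)"
      if fin: "finite Y" and oc: "one_cells P f = (\<lambda>y. (g y, y)) ` Y"
        and ys: "ys = rev (sorted_list_of_set Y)" for f g Y ys
    proof -
      let ?Y = "{y \<in> Y. g y \<noteq> x}"
      let ?ys = "rev (sorted_list_of_set ?Y)"
      have "one_cells P' f = {c \<in> one_cells P f. fst c \<noteq> x}" by (auto simp: one_cells_def P'_def)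
      also have "\<dots> = (\<lambda>y. (g y, y)) ` ?Y" by (simp only: oc Collect_image_conj fst_conv)
      finally have oc': "one_cells P' f = (\<lambda>y. (g y, y)) ` ?Y" .
      have "word_stat st xs (map (row_cells P') ?ys) (map g ?ys) =
          word_stat st xs (map (row_cells P) ys) (map g ys)" for st
      \<comment> \<open>The induction hypothesis speaks of the shortened word, whereas
        \<open>word_stat\<close> keeps the full one. Column sets \<open>D\<close> without
        \<open>x\<close> mask the extra letters.\<close>
      proof (rule word_stat_cong)
        fix z D assume "z \<in> set xs" "D \<subseteq> set xs"
        then have "z \<noteq> x" "x \<notin> D" using xs(1) by auto
        then show "block z D (map (row_cells P') ?ys) (map g ?ys) =
            block z D (map (row_cells P) ys) (map g ys)"
          unfolding block_map ys filter_rev_sorted_list_of_set[OF fin, symmetric] filter_filter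
          by (intro arg_cong[where f = "map g"] filter_cong) (auto simp: row_cells_def P'_def)
      qed
      then have "maj P' f = word_stat word_maj xs (map (row_cells P) ys) (map g ys)"
        "int (ne P' f) = word_stat word_inv xs (map (row_cells P) ys) (map g ys)"
        using stat[OF _ oc'] fin by (simp_all add: Let_def)
      moreover have "C' \<times> J \<subseteq> P" using C'_J_subset P'_subset by (rule order_trans)
      ultimately show ?thesis
        using maj_remove_column[of f] ne_remove_column[of f]
          product_eq_block[OF oc fin contiguous_C C_J_subset]
          product_eq_block[OF oc fin contiguous_C' \<open>C' \<times> J \<subseteq> P\<close>] set_xs xs(1) ys
        by simp
    qed
    ultimately show ?thesis
      using set_xs xs(2) by (intro exI[of _ "x # xs"]) (simp add: Let_def del: upper_part.simps)
  qed
qed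

section \<open>Column convexity along lists of rows\<close>

lemma subseq_mapE:
  assumes "subseq xs (map f ys)" obtains zs where "subseq zs ys" "xs = map f zs"
proof -
  obtain N where "xs = nths (map f ys) N" using assms subseq_conv_nths by blast
  then have "xs = map f (nths ys N)" by (simp add: nths_map)
  then show ?thesis using that subseq_conv_nths by blast
qed

lemma sorted_wrt_subseq: "subseq zs ys \<Longrightarrow> sorted_wrt R ys \<Longrightarrow> sorted_wrt R zs"
proof (induction rule: list_emb.induct)
  case (list_emb_Cons2 x y xs ys)
  then show ?case using list_emb_set[of "(=)" xs ys] by auto
qed auto

lemma unimodal_row_cells:
  assumes moon: "moon_polyomino P" and "sorted_wrt (>) ys"
  shows "unimodal (map (row_cells P) ys)"
  unfolding unimodal_def
proof (intro allI impI subsetI)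
  fix B1 B2 B3 x
  assume sub: "subseq [B1, B2, B3] (map (row_cells P) ys)" and x: "x \<in> B1 \<inter> B3"
  from sub obtain zs where zs: "subseq zs ys" "[B1, B2, B3] = map (row_cells P) zs"
    by (rule subseq_mapE)
  then obtain y1 y2 y3 where z: "zs = [y1, y2, y3]" and
    B: "B1 = row_cells P y1" "B2 = row_cells P y2" "B3 = row_cells P y3"
    by (auto simp: Cons_eq_map_conv)
  have "sorted_wrt (>) zs" using sorted_wrt_subseq zs(1) assms(2) by blast
  then have "y2 \<in> {y3..y1}" unfolding z by simp
  moreover have "{y3..y1} \<subseteq> column_cells P x"
    using moon_polyominoD(2)[OF moon, of x] x unfolding contiguous_def B
    by (simp add: mem_row_cells mem_column_cells)
  ultimately show "x \<in> B2" unfolding B by (auto simp: mem_row_cells mem_column_cells)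
qed

section \<open>The correspondence between fillings and words\<close>

definition row_letter :: "cell set \<Rightarrow> (cell \<Rightarrow> nat) \<Rightarrow> int \<Rightarrow> int" where
  "row_letter P f y = (THE x. (x, y) \<in> one_cells P f)"

text \<open>The value \<open>undefined\<close> off \<open>P\<close> makes the result extensional, as
  membership in \<open>fillings P\<close> demands.\<close>

definition filling_of :: "cell set \<Rightarrow> int set \<Rightarrow> (int \<Rightarrow> int) \<Rightarrow> cell \<Rightarrow> nat" where
  "filling_of P Y g = (\<lambda>(x, y). if (x, y) \<in> P then (if y \<in> Y \<and> g y = x then 1 else 0) else undefined)"

lemma one_cells_filling_of:
  assumes "\<And>y. y \<in> Y \<Longrightarrow> (g y, y) \<in> P"
  shows "one_cells P (filling_of P Y g) = (\<lambda>y. (g y, y)) ` Y"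
  using assms by (auto simp: one_cells_def filling_of_def split: if_splits)

lemma filling_of_one_cells:
  assumes "f \<in> P \<rightarrow>\<^sub>E {0, 1}" "one_cells P f = (\<lambda>y. (g y, y)) ` Y"
  shows "filling_of P Y g = f"
proof
  fix c :: cell
  obtain x y where c: "c = (x, y)" by fastforce
  have "f c = 1 \<longleftrightarrow> y \<in> Y \<and> g y = x" if "c \<in> P"
  proof -
    have "f c = 1 \<longleftrightarrow> c \<in> one_cells P f" using that by (simp add: one_cells_def)
    then show ?thesis unfolding assms(2) c by auto
  qed
  moreover have "f c = 0 \<or> f c = 1" if "c \<in> P" using assms(1) that by auto
  moreover have "f c = undefined" if "c \<notin> P" using assms(1) that by (rule PiE_arb)
  ultimately show "filling_of P Y g c = f c" by (auto simp: filling_of_def c)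
qed

lemma row_letter_eq:
  assumes "one_cells P f = (\<lambda>y. (g y, y)) ` Y" "y \<in> Y"
  shows "row_letter P f y = g y"
  unfolding row_letter_def assms(1) using assms(2) by (intro the_equality) auto

lemma one_cells_fillings:
  assumes P: "finite P" and f: "f \<in> fillings P"
  shows "one_cells P f = (\<lambda>y. (row_letter P f y, y)) ` nonempty_rows P f"
proof -
  have fin: "finite (one_cells P f)" using P by (simp add: one_cells_def)
  have uniq: "x = x'" if "(x, y) \<in> one_cells P f" "(x', y) \<in> one_cells P f" for x x' y
  proof -
    have "card {c \<in> one_cells P f. snd c = y} \<le> Suc 0" using f by (simp add: fillings_def)
    then have "(x, y) = (x', y)" using fin that by (subst (asm) card_le_Suc0_iff_eq) auto
    then show ?thesis by simp
  qed
  then have "row_letter P f y = x" if "(x, y) \<in> one_cells P f" for x y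
    unfolding row_letter_def using that by blast
  then show ?thesis by (force simp: nonempty_rows_def rows_def image_iff)
qed

text \<open>Writing the 1-cells as a graph over \<open>rows P - A\<close> already enforces one
  1-cell per row and the prescribed empty rows, so only the column counts remain.\<close>

lemma fillings_with_iff:
  assumes P: "finite P" and A: "A \<subseteq> rows P"
    and f: "f \<in> P \<rightarrow>\<^sub>E {0, 1}" and oc: "one_cells P f = (\<lambda>y. (g y, y)) ` (rows P - A)"
  shows "f \<in> fillings_with P s A \<longleftrightarrow> (\<forall>i<card (columns P).
     count_list (map g (rev (sorted_list_of_set (rows P - A)))) (sorted_list_of_set (columns P) ! i)
       = s ! i)"
proof -
  let ?Y = "rows P - A"
  have fin: "finite ?Y" using P by (simp add: rows_def)
  have "card {c \<in> one_cells P f. snd c = y} \<le> 1" for y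
  proof -
    have "{c \<in> one_cells P f. snd c = y} \<subseteq> {(g y, y)}" unfolding oc by auto
    then show ?thesis using card_mono[of "{(g y, y)}"] by fastforce
  qed
  then have "f \<in> fillings P" using f by (simp add: fillings_def)
  moreover have "nonempty_rows P f = ?Y" unfolding nonempty_rows_def oc rows_def by (simp add: image_image)
  \<comment> \<open>Here \<open>A \<subseteq> rows P\<close> enters: only then is
    \<open>rows P - (rows P - A)\<close> equal to \<open>A\<close>.\<close>
  then have "empty_rows P f = A" using A unfolding empty_rows_def by auto
  moreover have "card {c \<in> one_cells P f. fst c = x} =
      count_list (map g (rev (sorted_list_of_set ?Y))) x" for x
  proof -
    have "{c \<in> one_cells P f. fst c = x} = (\<lambda>y. (g y, y)) ` {y \<in> ?Y. g y = x}"
      unfolding oc by auto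
    then have "card {c \<in> one_cells P f. fst c = x} = card {y \<in> ?Y. g y = x}"
      by (simp add: card_image inj_on_def)
    also have "\<dots> = length (filter (\<lambda>y. g y = x) (rev (sorted_list_of_set ?Y)))"
      unfolding filter_rev_sorted_list_of_set[OF fin] by simp
    also have "\<dots> = count_list (map g (rev (sorted_list_of_set ?Y))) x"
      by (simp add: count_list_eq_length_filter filter_map o_def eq_commute)
    finally show ?thesis .
  qed
  ultimately show ?thesis by (simp add: fillings_with_def)
qed

lemma sum_fillings_with:
  fixes G :: "(cell \<Rightarrow> nat) \<Rightarrow> 'a::comm_monoid_add"
  assumes P: "finite P" and A: "A \<subseteq> rows P" and xs: "set xs = columns P"
    and s': "\<And>i. i < card (columns P) \<Longrightarrow> s' (sorted_list_of_set (columns P) ! i) = s ! i"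
  defines "ys \<equiv> rev (sorted_list_of_set (rows P - A))"
  assumes G: "\<And>f g. one_cells P f = (\<lambda>y. (g y, y)) ` (rows P - A) \<Longrightarrow> G f = H (map g ys)"
  shows "(\<Sum>f\<in>fillings_with P s A. G f) = (\<Sum>w\<in>shape_words xs (map (row_cells P) ys) s'. H w)"
proof -
  let ?Y = "rows P - A"
  \<comment> \<open>\<open>map_of (zip ys w)\<close> looks up the letter of row \<open>y\<close>,
    which is unambiguous because \<open>ys\<close> is distinct.\<close>
  let ?Psi = "\<lambda>w. filling_of P ?Y (\<lambda>y. the (map_of (zip ys w) y))"
  let ?Phi = "\<lambda>f. map (row_letter P f) ys"
  have fin: "finite ?Y" using P by (simp add: rows_def)
  have set_ys: "set ys = ?Y" and dist: "distinct ys" using fin by (simp_all add: ys_def)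
  have cols: "(!) (sorted_list_of_set (columns P)) ` {0..<card (columns P)} = columns P"
  proof -
    have "finite (columns P)" using P by (simp add: columns_def)
    then have "set (sorted_list_of_set (columns P)) = columns P" by simp
    then show ?thesis
      using nth_image[of "card (columns P)" "sorted_list_of_set (columns P)"] by simp
  qed
  have counts: "(\<forall>i<card (columns P). count_list w (sorted_list_of_set (columns P) ! i) = s ! i) \<longleftrightarrow>
      (\<forall>x\<in>set xs. count_list w x = s' x)" for w
  proof -
    have "(\<forall>x\<in>columns P. count_list w x = s' x) \<longleftrightarrow>
        (\<forall>x\<in>(!) (sorted_list_of_set (columns P)) ` {0..<card (columns P)}. count_list w x = s' x)"
      by (simp only: cols)
    then show ?thesis by (auto simp: xs s')
  qed
  have memF: "f \<in> fillings_with P s A \<longleftrightarrow> map g ys \<in> shape_words xs (map (row_cells P) ys) s'"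
    if f: "f \<in> P \<rightarrow>\<^sub>E {0, 1}" and oc: "one_cells P f = (\<lambda>y. (g y, y)) ` ?Y" for f g
  proof -
    have "(g y, y) \<in> P" if "y \<in> ?Y" for y
      using that oc unfolding one_cells_def by blast
    then have "list_all2 (\<in>) (map g ys) (map (row_cells P) ys)"
      by (simp add: list.rel_map list_all2_same mem_row_cells set_ys)
    then show ?thesis
      using fillings_with_iff[OF P A f oc] counts
      by (simp add: shape_words_def ys_def)
  qed
  have oc: "f \<in> P \<rightarrow>\<^sub>E {0, 1}" "one_cells P f = (\<lambda>y. (row_letter P f y, y)) ` ?Y"
    if "f \<in> fillings_with P s A" for f
  proof -
    have f: "f \<in> fillings P" "empty_rows P f = A" using that by (auto simp: fillings_with_def)
    then show "f \<in> P \<rightarrow>\<^sub>E {0, 1}" by (simp add: fillings_def)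
    have "nonempty_rows P f \<subseteq> rows P" by (auto simp: nonempty_rows_def rows_def one_cells_def)
    then have "nonempty_rows P f = ?Y" using f(2) unfolding empty_rows_def by blast
    then show "one_cells P f = (\<lambda>y. (row_letter P f y, y)) ` ?Y"
      using one_cells_fillings[OF P f(1)] by simp
  qed
  have map_w: "map (\<lambda>y. the (map_of (zip ys w) y)) ys = w" if "length w = length ys" for w :: "int list"
    using that dist by (intro nth_equalityI) (auto simp: map_of_zip_nth)
  have Psi: "?Psi w \<in> P \<rightarrow>\<^sub>E {0, 1}"
      "one_cells P (?Psi w) = (\<lambda>y. (the (map_of (zip ys w) y), y)) ` ?Y"
      "map (\<lambda>y. the (map_of (zip ys w) y)) ys = w"
    if "w \<in> shape_words xs (map (row_cells P) ys) s'" for w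
  proof -
    have w: "list_all2 (\<in>) w (map (row_cells P) ys)" using that by (simp add: shape_words_def)
    then show *: "map (\<lambda>y. the (map_of (zip ys w) y)) ys = w"
      by (intro map_w) (auto dest: list_all2_lengthD)
    have "(the (map_of (zip ys w) y), y) \<in> P" if y: "y \<in> ?Y" for y
    proof -
      have "list_all2 (\<in>) (map (\<lambda>y. the (map_of (zip ys w) y)) ys) (map (row_cells P) ys)"
        unfolding * by (rule w)
      then show ?thesis
        using y by (simp add: list.rel_map list_all2_same mem_row_cells set_ys)
    qed
    then show "one_cells P (?Psi w) = (\<lambda>y. (the (map_of (zip ys w) y), y)) ` ?Y"
      by (rule one_cells_filling_of)
    show "?Psi w \<in> P \<rightarrow>\<^sub>E {0, 1}" by (auto simp: filling_of_def PiE_iff extensional_def)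
  qed
  show ?thesis
  proof (rule sum.reindex_bij_witness[of _ ?Psi ?Phi])
    fix f assume f: "f \<in> fillings_with P s A"
    note oc = oc[OF f]
    show "?Phi f \<in> shape_words xs (map (row_cells P) ys) s'" using memF[OF oc] f by blast
    have len: "length (?Phi f) = length ys" by simp
    \<comment> \<open>\<open>filling_of_one_cells\<close> requires the 1-cells in terms of the very
      function inside \<open>?Psi\<close>, so \<open>row_letter\<close> is replaced by the
      lookup.\<close>
    have "row_letter P f y = the (map_of (zip ys (?Phi f)) y)" if "y \<in> ?Y" for y
      using map_w[OF len] that unfolding set_ys[symmetric] by (simp add: map_eq_conv)
    then have "one_cells P f = (\<lambda>y. (the (map_of (zip ys (?Phi f)) y), y)) ` ?Y"
      unfolding oc(2)[symmetric] by (subst oc(2)) (rule image_cong, auto)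
    then show "?Psi (?Phi f) = f" by (rule filling_of_one_cells[OF oc(1)])
    show "H (?Phi f) = G f" using G[OF oc(2)] by simp
  next
    fix w assume w: "w \<in> shape_words xs (map (row_cells P) ys) s'"
    note Psi = Psi[OF w]
    show "?Psi w \<in> fillings_with P s A" using memF[OF Psi(1,2)] Psi(3) w by simp
    have "?Phi (?Psi w) = map (\<lambda>y. the (map_of (zip ys w) y)) ys"
      using row_letter_eq[OF Psi(2)] set_ys by (intro map_cong) auto
    then show "?Phi (?Psi w) = w" using Psi(3) by simp
  qed
qed

theorem theorem4p5:
  fixes P :: "(int \<times> int) set" and m :: nat and s :: "nat list" and A :: "int set"
    and q :: "'a :: field"
  assumes "moon_polyomino P"
    and "card (columns P) = m"
    and "length s = m"
    and "A \<subseteq> rows P"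
  shows "(\<Sum>f\<in>fillings_with P s A. q powi maj P f) = (\<Sum>f\<in>fillings_with P s A. q ^ ne P f)"
proof -
  have fin: "finite P" using moon_polyominoD(1)[OF assms(1)] .
  obtain xs where xs: "set xs = columns P" "removal_order xs" "\<And>y. upper_part xs (row_cells P y)"
    and stat: "\<And>f g Y. finite Y \<Longrightarrow> one_cells P f = (\<lambda>y. (g y, y)) ` Y \<Longrightarrow>
       (let ys = rev (sorted_list_of_set Y); Bs = map (row_cells P) ys; w = map g ys in
         maj P f = word_stat word_maj xs Bs w \<and> int (ne P f) = word_stat word_inv xs Bs w)"
    using ex_removal_order[OF assms(1)] by blast
  define ys where "ys = rev (sorted_list_of_set (rows P - A))"
  define Bs where "Bs = map (row_cells P) ys"
  \<comment> \<open>\<open>s'\<close> turns the list \<open>s\<close> into a function on columns;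
    \<open>THE\<close> inverts the indexing of the sorted, hence distinct, list of columns.\<close>
  define s' where "s' x = s ! (THE i. i < card (columns P) \<and> sorted_list_of_set (columns P) ! i = x)" for x
  have s': "s' (sorted_list_of_set (columns P) ! i) = s ! i" if "i < card (columns P)" for i
  proof -
    have "(THE j. j < card (columns P) \<and>
        sorted_list_of_set (columns P) ! j = sorted_list_of_set (columns P) ! i) = i"
      using that by (intro the_equality) (auto simp: nth_eq_iff_index_eq)
    then show ?thesis by (simp add: s'_def)
  qed
  have finY: "finite (rows P - A)" using fin by (simp add: rows_def)
  have "(\<Sum>f\<in>fillings_with P s A. q powi maj P f) =
      (\<Sum>w\<in>shape_words xs Bs s'. q powi word_stat word_maj xs Bs w)"
    unfolding Bs_def ys_def using stat[OF finY]
    by (intro sum_fillings_with[OF fin assms(4) xs(1) s']) (auto simp: Let_def)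
  also have "\<dots> = (\<Sum>w\<in>shape_words xs Bs s'. q powi word_stat word_inv xs Bs w)"
  \<comment> \<open>Any function of the exponent may be tested, so \<open>q = 0\<close> is covered
    without a separate argument.\<close>
  proof (rule sum_word_stat_eq[where h = "\<lambda>k. q powi k"])
    show "insertion_invariant word_maj TYPE('a)" "insertion_invariant word_inv TYPE('a)"
      by (rule insertion_invariant_word_maj insertion_invariant_word_inv)+
    show "unimodal Bs" unfolding Bs_def ys_def
      by (rule unimodal_row_cells[OF assms(1) sorted_rev_sorted_list_of_set])
    show "\<forall>B\<in>set Bs. upper_part xs B" using xs(3) by (auto simp: Bs_def)
  qed (rule xs(2))
  also have "\<dots> = (\<Sum>f\<in>fillings_with P s A. q powi int (ne P f))"
    unfolding Bs_def ys_def using stat[OF finY]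
    by (intro sum_fillings_with[OF fin assms(4) xs(1) s', symmetric]) (auto simp: Let_def)
  finally show ?thesis by simp
qed

end
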